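(* Let $\mathcal P$ be a problem that is fixed-parameter tractable with parameter $k$, i.e. there is an $f(k)\,\mathrm{poly}(n)$-time Turing machine solving $\mathcal P$ for some computable $f$. Then there exists a $\mathrm{poly}(g(k))$-memory $(g(k)^2n^{g(k)},\,g(k)^2n^{g(k)})$-time TM-TLM that solves $\mathcal P$, where $g$ is a sufficiently large computable function.
   Context: A Turing machine with two-level memory (TM-TLM) with main memory size $M$ has a main memory tape of $M$ cells, an unbounded external memory tape, and an address tape for the external memory; it has a finite state set, alphabets and a transition function $\delta: Q\times\Gamma\to Q\times\Gamma\times\{L,S,R\}$ acting on the main memory tape, plus special read and write states: on entering a read state the machine writes an address $addr$ on the address tape and the main memory cell under the head receives the content of external cell $addr$; on entering a write state, external cell $addr$ receives the content of the main memory cell under the head. Each Read/Write is one IO operation of unit cost. Time = number of transitions other than Read/Write; IO time = number of Read/Write operations. An $M$-memory $(T,IO)$-time TM-TLM has main memory size $M$, time complexity $O(T)$ and IO complexity $O(IO)$. Here $n$ is the input size. *)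

theory Defs
  imports Main
begin

datatype dir = L | S | R

text \<open>States are 0..<tm_nq (0 = start, 1 = accept, 2 = reject; 1 and 2 are halting),
  tape symbols are 0..<tm_ns (0 = blank).  Inputs use the symbols 1, 2, 3.\<close>

record tm =
  tm_nq :: nat
  tm_ns :: nat
  tm_delta :: "nat \<Rightarrow> nat \<Rightarrow> nat \<times> nat \<times> dir"

definition tm_wf :: "tm \<Rightarrow> bool" where
  "tm_wf M \<longleftrightarrow> 3 \<le> tm_nq M \<and> 4 \<le> tm_ns M \<and>
     (\<forall>q a. q < tm_nq M \<longrightarrow> a < tm_ns M \<longrightarrow>
        fst (tm_delta M q a) < tm_nq M \<and> fst (snd (tm_delta M q a)) < tm_ns M)"

type_synonym tm_conf = "nat \<times> (int \<Rightarrow> nat) \<times> int"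

definition tm_halted :: "nat \<Rightarrow> bool" where
  "tm_halted q \<longleftrightarrow> q = 1 \<or> q = 2"

definition move_int :: "dir \<Rightarrow> int \<Rightarrow> int" where
  "move_int d h = (case d of L \<Rightarrow> h - 1 | S \<Rightarrow> h | R \<Rightarrow> h + 1)"

definition tm_step :: "tm \<Rightarrow> tm_conf \<Rightarrow> tm_conf" where
  "tm_step M c = (case c of (q, tp, h) \<Rightarrow>
     if tm_halted q then c
     else (case tm_delta M q (tp h) of (q', a', d) \<Rightarrow> (q', tp(h := a'), move_int d h)))"

definition tm_init :: "nat list \<Rightarrow> tm_conf" where
  "tm_init w = (0, (\<lambda>i. if 0 \<le> i \<and> i < int (length w) then w ! nat i else 0), 0)"

definition tm_run :: "tm \<Rightarrow> nat list \<Rightarrow> nat \<Rightarrow> tm_conf" where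
  "tm_run M w t = (tm_step M ^^ t) (tm_init w)"

definition computable :: "(nat \<Rightarrow> nat) \<Rightarrow> bool" where
  "computable f \<longleftrightarrow> (\<exists>M. tm_wf M \<and> (\<forall>k. \<exists>t.
      (case tm_run M (replicate k 1) t of (q, tp, h) \<Rightarrow>
         q = 1 \<and> (\<forall>i. 0 \<le> i \<and> i < int (f k) \<longrightarrow> tp i = 1) \<and> tp (int (f k)) = 0)))"

definition encode :: "bool list \<Rightarrow> nat \<Rightarrow> nat list" where
  "encode x k = map (\<lambda>b. if b then 2 else 1) x @ replicate k 3"

definition input_size :: "bool list \<Rightarrow> nat \<Rightarrow> nat" where
  "input_size x k = length (encode x k)"

definition tm_decides_in_time ::
    "tm \<Rightarrow> (bool list \<times> nat) set \<Rightarrow> (bool list \<Rightarrow> nat \<Rightarrow> nat) \<Rightarrow> bool" where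
  "tm_decides_in_time M P T \<longleftrightarrow> (\<forall>x k. \<exists>t \<le> T x k.
      tm_halted (fst (tm_run M (encode x k) t)) \<and>
      (fst (tm_run M (encode x k) t) = 1 \<longleftrightarrow> (x, k) \<in> P))"

text \<open>Fixed-parameter tractable: decided by a TM in time f(k) * poly(n), f computable.
  (Constant factors of O(-) and of the polynomial are absorbed into f; n is replaced by
  max 1 n so that the bound is meaningful for the empty input.)\<close>

definition fpt :: "(bool list \<times> nat) set \<Rightarrow> bool" where
  "fpt P \<longleftrightarrow> (\<exists>M f c. tm_wf M \<and> computable f \<and>
      tm_decides_in_time M P (\<lambda>x k. f k * (max 1 (input_size x k)) ^ c))"

text \<open>States 0..<tl_nq (0 start, 1 accept, 2 reject, halting), symbols 0..<tl_ns (0 blank).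
  The transition function acts on the main memory tape (cells 0..<M, the head is kept inside
  the tape).  In addition each transition may write one symbol onto the address tape
  (alphabet 0 = blank, 1 = bit 0, 2 = bit 1) and move its head; the address tape cannot be
  read by the transition function.  The address written on the address tape is the binary
  number formed by its cells 0,1,... up to the first blank (most significant bit first).
  Entering a read state copies external cell addr into the main memory cell under the head;
  entering a write state copies the main memory cell under the head into external cell addr.
  Each such operation costs one IO; every transition costs one unit of time.\<close>

record tlm =
  tl_nq :: nat
  tl_ns :: nat
  tl_delta :: "nat \<Rightarrow> nat \<Rightarrow> nat \<times> nat \<times> dir \<times> nat \<times> dir"
  tl_read :: "nat set"
  tl_write :: "nat set"

definition tlm_wf :: "tlm \<Rightarrow> bool" where
  "tlm_wf T \<longleftrightarrow> 3 \<le> tl_nq T \<and> 4 \<le> tl_ns T \<and>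
     tl_read T \<subseteq> {3..<tl_nq T} \<and> tl_write T \<subseteq> {3..<tl_nq T} \<and>
     tl_read T \<inter> tl_write T = {} \<and>
     (\<forall>q a. q < tl_nq T \<longrightarrow> a < tl_ns T \<longrightarrow>
        (case tl_delta T q a of (q', a', d, b, d') \<Rightarrow> q' < tl_nq T \<and> a' < tl_ns T \<and> b \<le> 2))"

record tlm_conf =
  c_state :: nat
  c_main :: "nat \<Rightarrow> nat"
  c_mhead :: nat
  c_ext :: "nat \<Rightarrow> nat"
  c_addr :: "nat \<Rightarrow> nat"
  c_ahead :: nat
  c_time :: nat
  c_io :: nat

definition move_main :: "nat \<Rightarrow> dir \<Rightarrow> nat \<Rightarrow> nat" where
  "move_main M d h = (case d of L \<Rightarrow> h - 1 | S \<Rightarrow> h | R \<Rightarrow> min (h + 1) (M - 1))"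

definition move_nat :: "dir \<Rightarrow> nat \<Rightarrow> nat" where
  "move_nat d h = (case d of L \<Rightarrow> h - 1 | S \<Rightarrow> h | R \<Rightarrow> h + 1)"

definition addr_len :: "(nat \<Rightarrow> nat) \<Rightarrow> nat" where
  "addr_len t = (LEAST i. t i = 0)"

definition addr_val :: "(nat \<Rightarrow> nat) \<Rightarrow> nat" where
  "addr_val t = (\<Sum>i<addr_len t. (t i - 1) * 2 ^ (addr_len t - 1 - i))"

definition tlm_step :: "tlm \<Rightarrow> nat \<Rightarrow> tlm_conf \<Rightarrow> tlm_conf" where
  "tlm_step T M c =
    (if tm_halted (c_state c) then c
     else (case tl_delta T (c_state c) (c_main c (c_mhead c)) of (q', a', d, b, d') \<Rightarrow>
       let main1 = (c_main c)((c_mhead c) := a');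
           h1 = move_main M d (c_mhead c);
           addr1 = (c_addr c)((c_ahead c) := b);
           ah1 = move_nat d' (c_ahead c);
           adr = addr_val addr1
       in if q' \<in> tl_read T then
            c\<lparr>c_state := q', c_main := main1(h1 := c_ext c adr), c_mhead := h1,
              c_addr := addr1, c_ahead := ah1, c_time := c_time c + 1, c_io := c_io c + 1\<rparr>
          else if q' \<in> tl_write T then
            c\<lparr>c_state := q', c_main := main1, c_mhead := h1, c_ext := (c_ext c)(adr := main1 h1),
              c_addr := addr1, c_ahead := ah1, c_time := c_time c + 1, c_io := c_io c + 1\<rparr>
          else
            c\<lparr>c_state := q', c_main := main1, c_mhead := h1,
              c_addr := addr1, c_ahead := ah1, c_time := c_time c + 1\<rparr>))"

definition tlm_init :: "nat list \<Rightarrow> tlm_conf" where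
  "tlm_init w = \<lparr>c_state = 0, c_main = (\<lambda>_. 0), c_mhead = 0,
     c_ext = (\<lambda>i. if i < length w then w ! i else 0),
     c_addr = (\<lambda>_. 0), c_ahead = 0, c_time = 0, c_io = 0\<rparr>"

definition tlm_run :: "tlm \<Rightarrow> nat \<Rightarrow> nat list \<Rightarrow> nat \<Rightarrow> tlm_conf" where
  "tlm_run T M w t = (tlm_step T M ^^ t) (tlm_init w)"

definition tlm_solves ::
    "tlm \<Rightarrow> (nat \<Rightarrow> nat) \<Rightarrow> (bool list \<times> nat) set \<Rightarrow>
     (bool list \<Rightarrow> nat \<Rightarrow> nat) \<Rightarrow> (bool list \<Rightarrow> nat \<Rightarrow> nat) \<Rightarrow> bool" where
  "tlm_solves T mem P Tm IO \<longleftrightarrow> (\<forall>x k. \<exists>t.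
      (let c = tlm_run T (mem k) (encode x k) t in
        tm_halted (c_state c) \<and> c_time c \<le> Tm x k \<and> c_io c \<le> IO x k \<and>
        (c_state c = 1 \<longleftrightarrow> (x, k) \<in> P)))"

end

theory Submission
  imports Defs
begin

text \<open>
  One main memory cell suffices.  The tape of the given machine is folded at the origin and kept in
  place in external memory, so that the input needs no copying.  The address tape cannot be read, and
  neither the state nor the main memory can hold an address of length \<open>log n\<close>; instead, every
  external cell at or below the current address \<open>p\<close> is tagged with the last bit of its own address,
  and the cells beyond \<open>p\<close> are untagged.  All prefixes of the binary address \<open>p\<close> are at most \<open>p\<close>,
  so the tags make the address tape a readable stack of bits.  To pass from \<open>p\<close> to \<open>p + 1\<close>, delete
  the trailing ones, turn the next zero into a one, and append zeros until an untagged cell is met: the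
  shorter addresses met on the way are at most \<open>p\<close>, hence tagged, so no counter is needed.
  Decrementing is similar.  A step at position \<open>p\<close> costs \<open>O(p + 1)\<close>, so \<open>t\<close> steps cost
  \<open>O((t + 1)\<^sup>2)\<close>, and with \<open>t \<le> f k * n ^ c\<close> the choice \<open>g k = f k + 2 * c + 1\<close> works.
\<close>

section \<open>Machines over arbitrary finite types\<close>

text \<open>The machine model fixes the codes of the start, accept and reject states and of the
  symbols 0 to 3, hence the prescribed prefix \<open>xs\<close>. As \<open>d\<close> maps every code
  back into \<open>A\<close>, closure of an abstract transition function carries over to its coded
  version.\<close>

lemma finite_coding_with_prefix:
  assumes "finite A" "distinct xs" "set xs \<subseteq> A"
  obtains e :: "'a \<Rightarrow> nat" and d where
    "\<And>a. a \<in> A \<Longrightarrow> e a < card A" "\<And>a. a \<in> A \<Longrightarrow> d (e a) = a"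
    "\<And>n. n < card A \<Longrightarrow> d n \<in> A" "\<And>i. i < length xs \<Longrightarrow> e (xs ! i) = i"
proof -
  obtain ys where ys: "set ys = A - set xs" "distinct ys"
    using finite_distinct_list assms(1) by (metis finite_Diff)
  define zs where "zs = xs @ ys"
  have zs: "set zs = A" "distinct zs" using ys assms by (auto simp: zs_def)
  then have len: "length zs = card A" using distinct_card by metis
  define e where "e a = (SOME i. i < length zs \<and> zs ! i = a)" for a
  have e: "e a < length zs \<and> zs ! e a = a" if "a \<in> A" for a
  proof -
    have "\<exists>i. i < length zs \<and> zs ! i = a" using that zs(1) by (auto simp: in_set_conv_nth)
    then show ?thesis unfolding e_def by (rule someI_ex)
  qed
  show ?thesis
  proof (rule that[of e "\<lambda>n. zs ! n"])
    fix i assume i: "i < length xs"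
    then have "zs ! i = xs ! i" "i < length zs" by (auto simp: zs_def nth_append)
    with e[of "xs ! i"] show "e (xs ! i) = i"
      using assms(3) i zs(2) by (metis nth_eq_iff_index_eq nth_mem subsetD)
  qed (use e len zs(1) in auto)
qed

definition atm_step ::
  "('s \<Rightarrow> 'y \<Rightarrow> 's \<times> 'y \<times> dir) \<Rightarrow> ('s \<Rightarrow> bool) \<Rightarrow> 's \<times> (int \<Rightarrow> 'y) \<times> int \<Rightarrow> 's \<times> (int \<Rightarrow> 'y) \<times> int" where
  "atm_step \<delta> hlt = (\<lambda>(s, tp, h). if hlt s then (s, tp, h)
     else (case \<delta> s (tp h) of (s', y, d) \<Rightarrow> (s', tp(h := y), move_int d h)))"

text \<open>Lets later machines use datatypes for states and symbols; \<open>ys\<close> translates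
  the input alphabet, with \<open>ys ! 0\<close> as the blank. Closure keeps all tape contents in
  \<open>Sy\<close>, where decoding inverts encoding.\<close>

lemma tm_realization:
  fixes \<delta> :: "'s \<Rightarrow> 'y \<Rightarrow> 's \<times> 'y \<times> dir"
  assumes fin: "finite St" "finite Sy"
    and s: "distinct [s0, s1, s2]" "{s0, s1, s2} \<subseteq> St"
    and ys: "distinct ys" "length ys = 4" "set ys \<subseteq> Sy"
    and closed: "\<And>s y s' y' d. s \<in> St \<Longrightarrow> y \<in> Sy \<Longrightarrow> \<delta> s y = (s', y', d) \<Longrightarrow> s' \<in> St \<and> y' \<in> Sy"
  obtains T e where "tm_wf T" "\<And>i. i < 4 \<Longrightarrow> e (ys ! i) = i"
    "\<And>w t s tp h. set w \<subseteq> {..<4} \<Longrightarrow>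
       (atm_step \<delta> (\<lambda>s. s = s1 \<or> s = s2) ^^ t)
          (s0, (\<lambda>i. if 0 \<le> i \<and> i < int (length w) then ys ! (w ! nat i) else ys ! 0), 0) = (s, tp, h) \<Longrightarrow>
       (s = s1 \<longrightarrow> fst (tm_run T w t) = 1) \<and> snd (tm_run T w t) = (e \<circ> tp, h)"
proof -
  obtain es ds where es: "\<And>a. a \<in> St \<Longrightarrow> es a < card St" "\<And>a. a \<in> St \<Longrightarrow> ds (es a) = a"
    "\<And>n. n < card St \<Longrightarrow> ds n \<in> St" "\<And>i. i < length [s0, s1, s2] \<Longrightarrow> es ([s0, s1, s2] ! i) = i"
    using finite_coding_with_prefix[OF fin(1) s(1)] s(2) by auto
  obtain ey dy where ey: "\<And>a. a \<in> Sy \<Longrightarrow> ey a < card Sy" "\<And>a. a \<in> Sy \<Longrightarrow> dy (ey a) = a"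
    "\<And>n. n < card Sy \<Longrightarrow> dy n \<in> Sy" "\<And>i. i < length ys \<Longrightarrow> ey (ys ! i) = i"
    using finite_coding_with_prefix[OF fin(2) ys(1,3)] by auto
  have es3: "es s0 = 0" "es s1 = 1" "es s2 = 2"
    using es(4)[of 0] es(4)[of 1] es(4)[of 2] by auto
  have hlt: "tm_halted (es a) \<longleftrightarrow> a = s1 \<or> a = s2" if "a \<in> St" for a
    using es3 es(2)[of a] es(2)[of s1] es(2)[of s2] that s(2) unfolding tm_halted_def by auto
  define T where "T = \<lparr>tm_nq = card St, tm_ns = card Sy,
     tm_delta = (\<lambda>q a. case \<delta> (ds q) (dy a) of (s', y', d) \<Rightarrow> (es s', ey y', d))\<rparr>"
  have "card {s0, s1, s2} \<le> card St" "card (set ys) \<le> card Sy"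
    by (rule card_mono; use fin s ys in simp)+
  then have "3 \<le> card St" "4 \<le> card Sy" using s(1) ys distinct_card[OF ys(1)] by auto
  moreover have "fst (tm_delta T q a) < card St \<and> fst (snd (tm_delta T q a)) < card Sy"
    if "q < card St" "a < card Sy" for q a
    using closed[OF es(3)[OF that(1)] ey(3)[OF that(2)]] es(1) ey(1)
    by (auto simp: T_def split: prod.splits)
  ultimately have wf: "tm_wf T"
    unfolding tm_wf_def by (simp add: T_def)
  have step: "tm_step T (es s, ey \<circ> tp, h) =
      (case atm_step \<delta> (\<lambda>s. s = s1 \<or> s = s2) (s, tp, h) of (s', tp', h') \<Rightarrow> (es s', ey \<circ> tp', h'))"
    if "s \<in> St" "range tp \<subseteq> Sy" for s tp h
  proof -
    have "tp h \<in> Sy" using that by auto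
    then show ?thesis
      using that hlt[of s] es(2)[of s] ey(2)[of "tp h"]
      by (auto simp: tm_step_def atm_step_def T_def fun_upd_def fun_eq_iff split: prod.splits)
  qed
  have inv: "s' \<in> St \<and> range tp' \<subseteq> Sy"
    if "s \<in> St" "range tp \<subseteq> Sy" "atm_step \<delta> (\<lambda>s. s = s1 \<or> s = s2) (s, tp, h) = (s', tp', h')"
    for s tp h s' tp' h'
  proof -
    have "tp h \<in> Sy" using that(2) by auto
    then show ?thesis
      using that closed[of s "tp h"] by (auto simp: atm_step_def image_subset_iff split: if_splits prod.splits)
  qed
  have main: "s \<in> St \<and> range tp \<subseteq> Sy \<and> tm_run T w t = (es s, ey \<circ> tp, h)"
    if w: "set w \<subseteq> {..<4}" and
      "(atm_step \<delta> (\<lambda>s. s = s1 \<or> s = s2) ^^ t)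
          (s0, (\<lambda>i. if 0 \<le> i \<and> i < int (length w) then ys ! (w ! nat i) else ys ! 0), 0) = (s, tp, h)"
    for w t s tp h
    using that(2)
  proof (induction t arbitrary: s tp h)
    case 0
    have w4: "w ! nat i < 4" if "0 \<le> i" "i < int (length w)" for i
      using w that nth_mem[of "nat i" w] by (auto simp: subset_iff)
    then have "ys ! (w ! nat i) \<in> Sy" "ey (ys ! (w ! nat i)) = w ! nat i"
      if "0 \<le> i" "i < int (length w)" for i
      using ys ey(4) that by (metis nth_mem subsetD)+
    moreover have "ys ! 0 \<in> Sy" "ey (ys ! 0) = 0"
      using ys ey(4)[of 0] nth_mem[of 0 ys] by auto
    moreover have "tp = (\<lambda>i. if 0 \<le> i \<and> i < int (length w) then ys ! (w ! nat i) else ys ! 0)"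
      "s = s0" "h = 0" using 0 by auto
    ultimately show ?case using s(2) es3 by (auto simp: tm_run_def tm_init_def o_def)
  next
    case (Suc t)
    obtain s' tp' h' where "(atm_step \<delta> (\<lambda>s. s = s1 \<or> s = s2) ^^ t)
          (s0, (\<lambda>i. if 0 \<le> i \<and> i < int (length w) then ys ! (w ! nat i) else ys ! 0), 0) = (s', tp', h')"
      using prod_cases3 by blast
    with Suc show ?case
      using inv[of s' tp' h' s tp h] step[of s' tp' h'] by (auto simp: tm_run_def o_def)
  qed
  show ?thesis
  proof (rule that[of T ey, OF wf])
    show "ey (ys ! i) = i" if "i < 4" for i using ey(4) ys(2) that by simp
  qed (use main es3 in simp)
qed

text \<open>
  A TM-TLM with a single main memory cell: its content is a register, and the main head never moves.
\<close>

definition atlm_step ::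
  "('s \<Rightarrow> 'y \<Rightarrow> 's \<times> 'y \<times> nat \<times> dir) \<Rightarrow> ('s \<Rightarrow> bool) \<Rightarrow> ('s \<Rightarrow> bool) \<Rightarrow> ('s \<Rightarrow> bool) \<Rightarrow>
   's \<times> 'y \<times> (nat \<Rightarrow> 'y) \<times> (nat \<Rightarrow> nat) \<times> nat \<Rightarrow> 's \<times> 'y \<times> (nat \<Rightarrow> 'y) \<times> (nat \<Rightarrow> nat) \<times> nat" where
  "atlm_step \<delta> rd wr hlt = (\<lambda>(s, y, E, A, h). if hlt s then (s, y, E, A, h)
     else (case \<delta> s y of (s', y', b, d) \<Rightarrow>
       (s', if rd s' then E (addr_val (A(h := b))) else y',
        if wr s' then E(addr_val (A(h := b)) := y') else E, A(h := b), move_nat d h)))"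

text \<open>With memory size 1, \<open>move_main\<close> never leaves cell 0, so the coded
  transitions always use direction \<open>S\<close>. Both halting states are tracked, since deciding
  a problem includes rejecting.\<close>

lemma tlm_realization:
  fixes \<delta> :: "'s \<Rightarrow> 'y \<Rightarrow> 's \<times> 'y \<times> nat \<times> dir"
  assumes fin: "finite St" "finite Sy"
    and s: "distinct [s0, s1, s2]" "{s0, s1, s2} \<subseteq> St"
    and ys: "distinct ys" "length ys = 4" "set ys \<subseteq> Sy"
    and closed: "\<And>s y s' y' b d. s \<in> St \<Longrightarrow> y \<in> Sy \<Longrightarrow> \<delta> s y = (s', y', b, d) \<Longrightarrow>
      s' \<in> St \<and> y' \<in> Sy \<and> b \<le> 2"
    and rw: "\<And>s. rd s \<Longrightarrow> \<not> wr s" "\<And>s. rd s \<or> wr s \<Longrightarrow> s \<notin> {s0, s1, s2}"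
  obtains T where "tlm_wf T"
    "\<And>w t s y E A h. set w \<subseteq> {..<4} \<Longrightarrow>
       (atlm_step \<delta> rd wr (\<lambda>s. s = s1 \<or> s = s2) ^^ t)
          (s0, ys ! 0, (\<lambda>i. if i < length w then ys ! (w ! i) else ys ! 0), (\<lambda>_. 0), 0) = (s, y, E, A, h) \<Longrightarrow>
       (c_state (tlm_run T 1 w t) = 1 \<longleftrightarrow> s = s1) \<and> (c_state (tlm_run T 1 w t) = 2 \<longleftrightarrow> s = s2)"
proof -
  let ?step = "atlm_step \<delta> rd wr (\<lambda>s. s = s1 \<or> s = s2)"
  obtain es ds where es: "\<And>a. a \<in> St \<Longrightarrow> es a < card St" "\<And>a. a \<in> St \<Longrightarrow> ds (es a) = a"
    "\<And>n. n < card St \<Longrightarrow> ds n \<in> St" "\<And>i. i < length [s0, s1, s2] \<Longrightarrow> es ([s0, s1, s2] ! i) = i"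
    using finite_coding_with_prefix[OF fin(1) s(1)] s(2) by auto
  obtain ey dy where ey: "\<And>a. a \<in> Sy \<Longrightarrow> ey a < card Sy" "\<And>a. a \<in> Sy \<Longrightarrow> dy (ey a) = a"
    "\<And>n. n < card Sy \<Longrightarrow> dy n \<in> Sy" "\<And>i. i < length ys \<Longrightarrow> ey (ys ! i) = i"
    using finite_coding_with_prefix[OF fin(2) ys(1,3)] by auto
  have es3: "es s0 = 0" "es s1 = 1" "es s2 = 2"
    using es(4)[of 0] es(4)[of 1] es(4)[of 2] by auto
  have es_inj: "es a = es b \<longleftrightarrow> a = b" if "a \<in> St" "b \<in> St" for a b
    using es(2) that by metis
  have hlt: "es a = 1 \<longleftrightarrow> a = s1" "es a = 2 \<longleftrightarrow> a = s2" if "a \<in> St" for a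
    using es3 es_inj[of a s1] es_inj[of a s2] that s(2) by auto
  have ge3: "3 \<le> es a" if "a \<in> St" "a \<notin> {s0, s1, s2}" for a
    using es3 es_inj[of a s0] es_inj[of a s1] es_inj[of a s2] that s(2) by auto
  define T where "T = \<lparr>tl_nq = card St, tl_ns = card Sy,
     tl_delta = (\<lambda>q a. case \<delta> (ds q) (dy a) of (s', y', b, d) \<Rightarrow> (es s', ey y', S, b, d)),
     tl_read = es ` {a \<in> St. rd a}, tl_write = es ` {a \<in> St. wr a}\<rparr>"
  have rdT: "es a \<in> tl_read T \<longleftrightarrow> rd a" "es a \<in> tl_write T \<longleftrightarrow> wr a" if "a \<in> St" for a
    using that es_inj by (auto simp: T_def image_iff)
  have "card {s0, s1, s2} \<le> card St" "card (set ys) \<le> card Sy"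
    by (rule card_mono; use fin s ys in simp)+
  then have "3 \<le> card St" "4 \<le> card Sy" using s(1) ys distinct_card[OF ys(1)] by auto
  moreover have "tl_read T \<subseteq> {3..<card St}" "tl_write T \<subseteq> {3..<card St}"
    using ge3 rw(2) es(1) by (auto simp: T_def)
  moreover have "tl_read T \<inter> tl_write T = {}"
    using rw(1) es_inj by (auto simp: T_def)
  moreover have "case tl_delta T q a of (q', a', d, b, d') \<Rightarrow> q' < card St \<and> a' < card Sy \<and> b \<le> 2"
    if "q < card St" "a < card Sy" for q a
    using closed[OF es(3)[OF that(1)] ey(3)[OF that(2)]] es(1) ey(1)
    by (auto simp: T_def split: prod.splits)
  ultimately have wf: "tlm_wf T"
    unfolding tlm_wf_def by (simp add: T_def)
  \<comment> \<open>The relation ignores the two cost counters, which are bounded separately by the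
    number of steps, and all main cells other than 0.\<close>
  define rep where "rep c = (\<lambda>(s, y, E, A, h). s \<in> St \<and> y \<in> Sy \<and> range E \<subseteq> Sy \<and>
     c_state c = es s \<and> c_main c 0 = ey y \<and> c_mhead c = 0 \<and> c_ext c = ey \<circ> E \<and>
     c_addr c = A \<and> c_ahead c = h)" for c :: tlm_conf
  have step: "rep (tlm_step T 1 c) (?step (s, y, E, A, h))" if r: "rep c (s, y, E, A, h)" for c s y E A h
  proof (cases "s = s1 \<or> s = s2")
    case True
    with r show ?thesis using hlt[of s] by (auto simp: rep_def tlm_step_def atlm_step_def tm_halted_def)
  next
    case False
    obtain s' y' b d where \<delta>: "\<delta> s y = (s', y', b, d)" using prod_cases4 by blast
    have c: "s \<in> St" "y \<in> Sy" "range E \<subseteq> Sy" "c_state c = es s" "c_main c 0 = ey y" "c_mhead c = 0"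
      "c_ext c = ey \<circ> E" "c_addr c = A" "c_ahead c = h" using r by (auto simp: rep_def)
    have cl: "s' \<in> St" "y' \<in> Sy" using closed[OF c(1,2) \<delta>] by auto
    have nh: "\<not> tm_halted (c_state c)" using False hlt[of s] c by (auto simp: tm_halted_def)
    have \<delta>T: "tl_delta T (es s) (ey y) = (es s', ey y', S, b, d)"
      using es(2)[OF c(1)] ey(2)[OF c(2)] \<delta> by (simp add: T_def)
    have "tlm_step T 1 c = (let adr = addr_val (A(h := b)); main1 = (c_main c)(0 := ey y') in
        if rd s' then c\<lparr>c_state := es s', c_main := main1(0 := ey (E adr)), c_mhead := 0,
              c_addr := A(h := b), c_ahead := move_nat d h, c_time := c_time c + 1, c_io := c_io c + 1\<rparr>
          else if wr s' then
            c\<lparr>c_state := es s', c_main := main1, c_mhead := 0, c_ext := (c_ext c)(adr := ey y'),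
              c_addr := A(h := b), c_ahead := move_nat d h, c_time := c_time c + 1, c_io := c_io c + 1\<rparr>
          else
            c\<lparr>c_state := es s', c_main := main1, c_mhead := 0,
              c_addr := A(h := b), c_ahead := move_nat d h, c_time := c_time c + 1\<rparr>)"
      using nh rdT[OF cl(1)] c by (simp add: tlm_step_def \<delta>T move_main_def Let_def)
    then show ?thesis
      using False \<delta> c cl rw(1) by (auto simp: rep_def atlm_step_def Let_def fun_eq_iff)
  qed
  have main: "rep (tlm_run T 1 w t) ((?step ^^ t)
          (s0, ys ! 0, (\<lambda>i. if i < length w then ys ! (w ! i) else ys ! 0), (\<lambda>_. 0), 0))"
    if w: "set w \<subseteq> {..<4}" for w t
  proof (induction t)
    case 0
    have w4: "w ! i < 4" if "i < length w" for i
      using w that nth_mem[of i w] by (auto simp: subset_iff)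
    then have "ys ! (w ! i) \<in> Sy" "ey (ys ! (w ! i)) = w ! i" if "i < length w" for i
      using ys ey(4) that by (metis nth_mem subsetD)+
    moreover have "ys ! 0 \<in> Sy" "ey (ys ! 0) = 0"
      using ys ey(4)[of 0] nth_mem[of 0 ys] by auto
    ultimately show ?case using s(2) es3 by (auto simp: rep_def tlm_run_def tlm_init_def fun_eq_iff)
  next
    case (Suc t)
    then show ?case using step by (cases "(?step ^^ t)
          (s0, ys ! 0, (\<lambda>i. if i < length w then ys ! (w ! i) else ys ! 0), (\<lambda>_. 0), 0)")
        (auto simp: tlm_run_def)
  qed
  show ?thesis
  proof (rule that[of T, OF wf])
    fix w t s y E A h
    assume "set w \<subseteq> {..<4}" and "(?step ^^ t)
          (s0, ys ! 0, (\<lambda>i. if i < length w then ys ! (w ! i) else ys ! 0), (\<lambda>_. 0), 0) = (s, y, E, A, h)"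
    with main[of w t] hlt[of s]
    show "(c_state (tlm_run T 1 w t) = 1 \<longleftrightarrow> s = s1) \<and> (c_state (tlm_run T 1 w t) = 2 \<longleftrightarrow> s = s2)"
      by (auto simp: rep_def)
  qed
qed

text \<open>One transition raises either counter by at most one, so a single bound on the number of
  steps bounds time and IO together.\<close>

lemma tlm_run_cost: "c_time (tlm_run T m w t) \<le> t \<and> c_io (tlm_run T m w t) \<le> t"
proof (induction t)
  case 0
  show ?case by (simp add: tlm_run_def tlm_init_def)
next
  case (Suc t)
  have "c_time (tlm_step T m c) \<le> Suc (c_time c) \<and> c_io (tlm_step T m c) \<le> Suc (c_io c)" for c
    by (auto simp: tlm_step_def Let_def split: prod.splits)
  from this[of "tlm_run T m w t"] Suc show ?case by (auto simp: tlm_run_def)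
qed

section \<open>Adding a constant to a computable function\<close>

text \<open>
  Nothing is known about the head position or the tape outside the output cells when a machine for
  \<open>f\<close> accepts.  So the origin is marked (the boolean of a symbol), and the state
  \<open>SGo q s\<close> remembers in \<open>s\<close> whether the head is to the left of the origin; at the origin
  itself \<open>s\<close> is irrelevant.
\<close>

datatype suc_state = SStart | SAcc | SRej | SGo nat bool | SFwd | SEnd

text \<open>When \<open>F\<close> accepts, the head walks back to the mark and erases it, since only
  the unmarked symbol \<open>(1, False)\<close> gets code 1. The scan from the origin then turns the
  first symbol other than 1 into 1 and blanks the next cell, which may hold leftovers.\<close>

fun suc_delta :: "tm \<Rightarrow> suc_state \<Rightarrow> nat \<times> bool \<Rightarrow> suc_state \<times> (nat \<times> bool) \<times> dir" where
  "suc_delta F SStart (a, m) = (SGo 0 False, (a, True), S)"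
| "suc_delta F SAcc y = (SAcc, y, S)"
| "suc_delta F SRej y = (SRej, y, S)"
| "suc_delta F (SGo q s) (a, m) =
    (if q = 1 then
       if m then if a = 1 then (SFwd, (1, False), R) else (SEnd, (1, False), R)
       else (SGo q s, (a, m), if s then R else L)
     else case tm_delta F q a of (q', a', d) \<Rightarrow> (SGo q' (if m then d = L else s), (a', m), d))"
| "suc_delta F SFwd (a, m) = (if a = 1 then (SFwd, (a, m), R) else (SEnd, (1, False), R))"
| "suc_delta F SEnd y = (SAcc, (0, False), S)"

abbreviation suc_step :: "tm \<Rightarrow> suc_state \<times> (int \<Rightarrow> nat \<times> bool) \<times> int \<Rightarrow> suc_state \<times> (int \<Rightarrow> nat \<times> bool) \<times> int" where
  "suc_step F \<equiv> atm_step (suc_delta F) (\<lambda>s. s = SAcc \<or> s = SRej)"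

lemma funpow_reach_step: "f x = y \<Longrightarrow> \<exists>t. (f ^^ t) y = z \<Longrightarrow> \<exists>t. (f ^^ t) x = z"
  by (metis funpow_Suc_right o_apply)

lemma funpow_reach_trans: "(f ^^ t) x = y \<Longrightarrow> \<exists>t. (f ^^ t) y = z \<Longrightarrow> \<exists>t. (f ^^ t) x = z"
  by (metis funpow_add o_apply)

text \<open>The rejecting state of \<open>F\<close> is not treated as halting here, so the induction
  claims the invariant only for \<open>q \<noteq> 2\<close>; this suffices because a run that ends
  in state 1 never passes through state 2.\<close>

lemma suc_simulates:
  assumes "tm_run F w t = (1, tp, h)"
  shows "\<exists>t' s. (suc_step F ^^ t') (SGo 0 False, (\<lambda>i. (fst (snd (tm_init w)) i, i = 0)), 0)
     = (SGo 1 s, (\<lambda>i. (tp i, i = 0)), h) \<and> (h \<noteq> 0 \<longrightarrow> s = (h < 0))"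
proof -
  have "q \<noteq> 2 \<Longrightarrow> \<exists>t' s. (suc_step F ^^ t') (SGo 0 False, (\<lambda>i. (fst (snd (tm_init w)) i, i = 0)), 0)
     = (SGo q s, (\<lambda>i. (tp i, i = 0)), h) \<and> (h \<noteq> 0 \<longrightarrow> s = (h < 0))"
    if "tm_run F w t = (q, tp, h)" for q tp h
    using that
  proof (induction t arbitrary: q tp h)
    case 0
    then show ?case by (intro exI[of _ 0]) (auto simp: tm_run_def tm_init_def)
  next
    case (Suc t)
    obtain q0 tp0 h0 where r: "tm_run F w t = (q0, tp0, h0)" using prod_cases3 by blast
    have st: "tm_step F (q0, tp0, h0) = (q, tp, h)" using Suc.prems(2) r by (simp add: tm_run_def)
    have "q0 \<noteq> 2" using st Suc.prems(1) by (auto simp: tm_step_def tm_halted_def)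
    then obtain t' s where IH: "(suc_step F ^^ t') (SGo 0 False, (\<lambda>i. (fst (snd (tm_init w)) i, i = 0)), 0)
       = (SGo q0 s, (\<lambda>i. (tp0 i, i = 0)), h0)" "h0 \<noteq> 0 \<longrightarrow> s = (h0 < 0)"
      using Suc.IH[OF _ r] by blast
    show ?case
    proof (cases "q0 = 1")
      case True
      then show ?thesis using IH st by (auto simp: tm_step_def tm_halted_def)
    next
      case False
      obtain q' a' d where \<delta>: "tm_delta F q0 (tp0 h0) = (q', a', d)" using prod_cases3 by blast
      have q: "q = q'" "tp = tp0(h0 := a')" "h = move_int d h0"
        using st \<delta> False \<open>q0 \<noteq> 2\<close> by (auto simp: tm_step_def tm_halted_def)
      have "suc_step F (SGo q0 s, (\<lambda>i. (tp0 i, i = 0)), h0) =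
          (SGo q (if h0 = 0 then d = L else s), (\<lambda>i. (tp i, i = 0)), h)"
        using False \<delta> by (auto simp: atm_step_def q fun_eq_iff)
      moreover have "h \<noteq> 0 \<longrightarrow> (if h0 = 0 then d = L else s) = (h < 0)"
        using IH(2) by (auto simp: q move_int_def split: dir.splits)
      ultimately show ?thesis using IH(1)
        by (intro exI[of _ "Suc t'"] exI[of _ "if h0 = 0 then d = L else s"]) simp
    qed
  qed
  from this[OF assms] show ?thesis by simp
qed

lemma suc_return:
  assumes "\<And>i. snd (tp i) = (i = 0)" "h \<noteq> 0 \<longrightarrow> s = (h < 0)"
  shows "\<exists>t. (suc_step F ^^ t) (SGo 1 s, tp, h) = (SGo 1 s, tp, 0)"
  using assms(2)
proof (induction "nat \<bar>h\<bar>" arbitrary: h rule: less_induct)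
  case less
  show ?case
  proof (cases "h = 0")
    case True
    then show ?thesis by (intro exI[of _ 0]) simp
  next
    case False
    let ?h = "if s then h + 1 else h - 1"
    have "suc_step F (SGo 1 s, tp, h) = (SGo 1 s, tp, ?h)"
      using False assms(1)[of h] by (cases "tp h") (auto simp: atm_step_def move_int_def fun_eq_iff)
    moreover have "\<exists>t. (suc_step F ^^ t) (SGo 1 s, tp, ?h) = (SGo 1 s, tp, 0)"
      using less False by (intro less.hyps) auto
    ultimately show ?thesis by (rule funpow_reach_step)
  qed
qed

lemma suc_forward:
  assumes "\<And>i. i > 0 \<Longrightarrow> i < int n \<Longrightarrow> fst (tp i) = 1" "fst (tp (int n)) = 0" "0 < j" "j \<le> n"
  shows "\<exists>t. (suc_step F ^^ t) (SFwd, tp, int j) = (SEnd, tp(int n := (1, False)), int n + 1)"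
  using assms(4,3)
proof (induction rule: inc_induct)
  case base
  show ?case using assms(2)
    by (intro exI[of _ 1]; cases "tp (int n)") (auto simp: atm_step_def move_int_def)
next
  case (step j)
  then have "fst (tp (int j)) = 1" using assms(1) by auto
  then have "suc_step F (SFwd, tp, int j) = (SFwd, tp, int (Suc j))"
    by (cases "tp (int j)") (auto simp: atm_step_def move_int_def fun_eq_iff)
  from this step.IH show ?case by (rule funpow_reach_step) simp
qed

lemma computable_Suc:
  assumes "computable f"
  shows "computable (\<lambda>k. Suc (f k))"
proof -
  obtain F where wf: "tm_wf F" and F: "\<And>k. \<exists>t. (case tm_run F (replicate k 1) t of (q, tp, h) \<Rightarrow>
         q = 1 \<and> (\<forall>i. 0 \<le> i \<and> i < int (f k) \<longrightarrow> tp i = 1) \<and> tp (int (f k)) = 0)"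
    using assms unfolding computable_def by blast
  let ?St = "{SStart, SAcc, SRej, SFwd, SEnd} \<union> case_prod SGo ` ({..<tm_nq F} \<times> UNIV)"
  let ?Sy = "{..<tm_ns F} \<times> (UNIV :: bool set)"
  let ?ys = "map (\<lambda>a. (a, False)) [0, 1, 2, 3 :: nat]"
  have n: "3 \<le> tm_nq F" "4 \<le> tm_ns F" using wf by (auto simp: tm_wf_def)
  have closed: "s' \<in> ?St \<and> y' \<in> ?Sy"
    if "s \<in> ?St" "y \<in> ?Sy" "suc_delta F s y = (s', y', d)" for s y s' y' d
  proof (cases s)
    case (SGo q b)
    obtain a m where y: "y = (a, m)" by (cases y)
    have "q < tm_nq F" "a < tm_ns F" using that SGo y by auto
    then have "fst (tm_delta F q a) < tm_nq F" "fst (snd (tm_delta F q a)) < tm_ns F"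
      using wf by (auto simp: tm_wf_def)
    then show ?thesis using that n SGo y by (auto split: if_splits prod.splits)
  qed (use that n in \<open>cases y; auto split: if_splits\<close>)+
  have sets: "finite ?St" "finite ?Sy" "distinct [SStart, SAcc, SRej]" "{SStart, SAcc, SRej} \<subseteq> ?St"
    "distinct ?ys" "length ?ys = 4" "set ?ys \<subseteq> ?Sy"
    using n by auto
  obtain T e where T: "tm_wf T" "\<And>i. i < 4 \<Longrightarrow> e (?ys ! i) = i"
    "\<And>w t s tp h. set w \<subseteq> {..<4} \<Longrightarrow>
       (suc_step F ^^ t)
          (SStart, (\<lambda>i. if 0 \<le> i \<and> i < int (length w) then ?ys ! (w ! nat i) else ?ys ! 0), 0) = (s, tp, h) \<Longrightarrow>
       (s = SAcc \<longrightarrow> fst (tm_run T w t) = 1) \<and> snd (tm_run T w t) = (e \<circ> tp, h)"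
    by (rule tm_realization[OF sets closed]) (assumption | rule that)+
  have e: "e (0, False) = 0" "e (1, False) = 1" using T(2)[of 0] T(2)[of 1] by auto
  have "\<exists>t. case tm_run T (replicate k 1) t of (q, tp, h) \<Rightarrow> q = 1 \<and>
      (\<forall>i. 0 \<le> i \<and> i < int (Suc (f k)) \<longrightarrow> tp i = 1) \<and> tp (int (Suc (f k))) = 0" for k
  proof -
    let ?w = "replicate k (1 :: nat)"
    let ?init = "\<lambda>i. if 0 \<le> i \<and> i < int (length ?w) then ?ys ! (?w ! nat i) else ?ys ! 0"
    obtain t where t: "case tm_run F ?w t of (q, tp, h) \<Rightarrow>
         q = 1 \<and> (\<forall>i. 0 \<le> i \<and> i < int (f k) \<longrightarrow> tp i = 1) \<and> tp (int (f k)) = 0"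
      using F[of k] by (rule exE)
    obtain q tp h where qth: "tm_run F ?w t = (q, tp, h)" using prod_cases3 by blast
    with t have run: "tm_run F ?w t = (1, tp, h)"
      and ones: "\<And>i. 0 \<le> i \<Longrightarrow> i < int (f k) \<Longrightarrow> tp i = 1" and zero: "tp (int (f k)) = 0"
      by auto
    let ?tp = "\<lambda>i. (tp i, i = 0)"
    let ?tp1 = "?tp(0 := (1, False))"
    let ?tp2 = "?tp1(int (f k) := (1, False))"
    let ?fin = "(SAcc, ?tp2(int (f k) + 1 := (0, False)), int (f k) + 1)"
    have init: "suc_step F (SStart, ?init, 0) = (SGo 0 False, (\<lambda>i. (fst (snd (tm_init ?w)) i, i = 0)), 0)"
      by (auto simp: atm_step_def tm_init_def move_int_def fun_eq_iff)
    have fin: "\<exists>t. (suc_step F ^^ t) (SEnd, ?tp2, int (f k) + 1) = ?fin"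
      by (intro exI[of _ 1]) (simp add: atm_step_def move_int_def)
    have ret: "\<exists>t. (suc_step F ^^ t) (SGo 1 s, ?tp, 0) = ?fin" for s
    proof (cases "f k = 0")
      \<comment> \<open>The origin is itself the first cell that does not hold 1, so the scan in
        state \<open>SFwd\<close> is skipped.\<close>
      case True
      then have "suc_step F (SGo 1 s, ?tp, 0) = (SEnd, ?tp2, int (f k) + 1)"
        using zero by (auto simp: atm_step_def move_int_def fun_eq_iff)
      from this fin show ?thesis by (rule funpow_reach_step)
    next
      case False
      then have "suc_step F (SGo 1 s, ?tp, 0) = (SFwd, ?tp1, int 1)"
        using ones[of 0] by (auto simp: atm_step_def move_int_def fun_eq_iff)
      moreover
      have "\<exists>t. (suc_step F ^^ t) (SFwd, ?tp1, int 1) = (SEnd, ?tp2, int (f k) + 1)"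
        using False ones zero by (intro suc_forward) auto
      then obtain t where "(suc_step F ^^ t) (SFwd, ?tp1, int 1) = (SEnd, ?tp2, int (f k) + 1)" by (rule exE)
      from this fin have "\<exists>t. (suc_step F ^^ t) (SFwd, ?tp1, int 1) = ?fin" by (rule funpow_reach_trans)
      ultimately show ?thesis by (rule funpow_reach_step)
    qed
    obtain t1 s where t1: "(suc_step F ^^ t1) (SGo 0 False, (\<lambda>i. (fst (snd (tm_init ?w)) i, i = 0)), 0)
       = (SGo 1 s, ?tp, h)" "h \<noteq> 0 \<longrightarrow> s = (h < 0)"
      using suc_simulates[OF run] by blast
    then have "\<exists>t. (suc_step F ^^ t) (SGo 1 s, ?tp, h) = (SGo 1 s, ?tp, 0)"
      by (intro suc_return) auto
    then obtain t2 where t2: "(suc_step F ^^ t2) (SGo 1 s, ?tp, h) = (SGo 1 s, ?tp, 0)" by (rule exE)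
    have "\<exists>t. (suc_step F ^^ t) (SStart, ?init, 0) = ?fin"
      by (rule funpow_reach_step[OF init funpow_reach_trans[OF t1(1) funpow_reach_trans[OF t2 ret]]])
    then obtain t where t: "(suc_step F ^^ t) (SStart, ?init, 0) = ?fin" by (rule exE)
    have "set ?w \<subseteq> {..<4}" by auto
    from T(3)[OF this t] have "fst (tm_run T ?w t) = 1"
      "snd (tm_run T ?w t) = (e \<circ> ?tp2(int (f k) + 1 := (0, False)), int (f k) + 1)"
      by simp_all
    then show ?thesis using ones e by (intro exI[of _ t]) (auto split: prod.splits)
  qed
  with T(1) show ?thesis unfolding computable_def by blast
qed

lemma computable_add_const: "computable f \<Longrightarrow> computable (\<lambda>k. f k + c)"
  by (induction c) (simp_all add: computable_Suc)

section \<open>Binary addresses\<close>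

text \<open>Most significant bit first, in the address alphabet (1 for bit 0, 2 for bit 1) and
  without leading zeros. Every address thus has one canonical tape, that of 0 is blank, and popping
  the last bit is halving.\<close>

fun addr_bits :: "nat \<Rightarrow> nat list" where
  "addr_bits p = (if p = 0 then [] else addr_bits (p div 2) @ [if odd p then 2 else 1])"

declare addr_bits.simps [simp del]

definition alen :: "nat \<Rightarrow> nat" where
  "alen p = length (addr_bits p)"

definition atape :: "nat \<Rightarrow> nat \<Rightarrow> nat" where
  "atape p i = (if i < alen p then addr_bits p ! i else 0)"

lemma alen_0 [simp]: "alen 0 = 0"
  by (simp add: alen_def addr_bits.simps)

lemma alen_rec: "0 < p \<Longrightarrow> alen p = Suc (alen (p div 2))"
  by (simp add: alen_def addr_bits.simps[of p])

lemma atape_rec: "0 < p \<Longrightarrow> atape p = (atape (p div 2))(alen (p div 2) := if odd p then 2 else 1)"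
  by (auto simp: atape_def alen_rec fun_eq_iff nth_append addr_bits.simps[of p] alen_def)

text \<open>A head that has stepped back onto the last bit deletes or exchanges this bit by its next
  write.\<close>

lemma atape_overwrite [simp]:
  "(atape (Suc (2 * p)))(alen p := b) = (atape p)(alen p := b)"
  "0 < p \<Longrightarrow> (atape (2 * p))(alen p := b) = (atape p)(alen p := b)"
  using atape_rec[of "Suc (2 * p)"] atape_rec[of "2 * p"] by simp_all

lemma atape_blank [simp]: "alen p \<le> i \<Longrightarrow> atape p i = 0"
  by (simp add: atape_def)

lemma atape_0 [simp]: "atape 0 = (\<lambda>_. 0)"
  by (simp add: fun_eq_iff)

lemma atape_stay [simp]: "alen p \<le> i \<Longrightarrow> (atape p)(i := 0) = atape p"
  by (auto simp: fun_eq_iff)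

lemma atape_push1 [simp]: "(atape p)(alen p := 2) = atape (Suc (2 * p))"
  using atape_rec[of "Suc (2 * p)"] by simp

text \<open>A zero pushed onto the empty word would be a leading zero, hence
  \<open>0 < p\<close>.\<close>

lemma atape_push0 [simp]: "0 < p \<Longrightarrow> (atape p)(alen p := Suc 0) = atape (2 * p)"
  using atape_rec[of "2 * p"] by simp

lemma alen_push1 [simp]: "alen (Suc (2 * p)) = Suc (alen p)"
  using alen_rec[of "Suc (2 * p)"] by simp

lemma alen_push0 [simp]: "0 < p \<Longrightarrow> alen (2 * p) = Suc (alen p)"
  using alen_rec[of "2 * p"] by simp

lemma atape_1 [simp]:
  "(\<lambda>_. 0)(0 := 2) = atape (Suc 0)" "(\<lambda>_. 0)(i := 0) = (\<lambda>_. 0 :: nat)" "(atape (Suc 0))(0 := b) = (\<lambda>_. 0)(0 := b)" "alen (Suc 0) = Suc 0"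
  using atape_push1[of 0] atape_overwrite(1)[of 0 b] alen_push1[of 0] by auto

lemma addr_len_atape: "addr_len (atape p) = alen p"
proof -
  have "set (addr_bits p) \<subseteq> {1, 2}"
    by (induction p rule: addr_bits.induct) (subst addr_bits.simps; auto)
  then have nz: "atape p i \<noteq> 0" if "i < alen p" for i
    using that nth_mem[of i "addr_bits p"] by (fastforce simp: atape_def alen_def)
  show ?thesis
    unfolding addr_len_def
  proof (rule Least_equality)
    show "alen p \<le> i" if "atape p i = 0" for i using nz that not_le by blast
  qed simp
qed

text \<open>Horner's rule: splitting off the last bit halves the weights of all the others.\<close>

lemma addr_val_atape [simp]: "addr_val (atape p) = p"
proof (induction p rule: less_induct)
  case (less p)
  show ?case
  proof (cases "p = 0")
    case True
    then show ?thesis by (simp add: addr_val_def addr_len_atape del: atape_0)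
  next
    case False
    let ?q = "p div 2"
    have "addr_val (atape p) = (\<Sum>i<alen ?q. (atape p i - 1) * 2 ^ (alen ?q - i)) + (atape p (alen ?q) - 1)"
      using False by (simp add: addr_val_def addr_len_atape alen_rec)
    also have "(\<Sum>i<alen ?q. (atape p i - 1) * 2 ^ (alen ?q - i)) =
        (\<Sum>i<alen ?q. 2 * ((atape ?q i - 1) * 2 ^ (alen ?q - 1 - i)))"
    proof (rule sum.cong)
      fix i assume "i \<in> {..<alen ?q}"
      then have "alen ?q - i = Suc (alen ?q - 1 - i)" by auto
      with \<open>i \<in> _\<close> False show "(atape p i - 1) * 2 ^ (alen ?q - i) =
          2 * ((atape ?q i - 1) * 2 ^ (alen ?q - 1 - i))"
        by (simp add: atape_rec)
    qed simp
    also have "\<dots> = 2 * addr_val (atape ?q)"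
      by (simp add: addr_val_def addr_len_atape sum_distrib_left)
    also have "\<dots> = 2 * ?q" using less False by simp
    also have "atape p (alen ?q) - 1 = p mod 2" using False by (simp add: atape_rec odd_iff_mod_2_eq_one)
    finally show ?thesis by simp
  qed
qed

lemma addr_val_blank [simp]: "addr_val (\<lambda>_. 0) = 0"
  using addr_val_atape[of 0] by simp

text \<open>
  \<open>Bit0\<close> and \<open>Bit1\<close> record the last bit of the address of a cell at or below the head of the
  simulated machine, \<open>Root\<close> marks cell 0, and all cells beyond the head are \<open>Free\<close>.
\<close>

datatype tag = Free | Bit0 | Bit1 | Root

text \<open>
  The suffixes \<open>W\<close> and \<open>R\<close> are write and read states.  \<open>IncW\<close>, \<open>IncR\<close>, \<open>DecW\<close>, \<open>DecR\<close>
  delete trailing bits; since every transition overwrites the cell under the address head, deleting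
  takes two transitions, with \<open>Inc0\<close>, \<open>Inc1\<close>, \<open>Dec0\<close>, \<open>Dec1\<close>, \<open>DecL\<close> in between.
  \<open>IncZ\<close> appends zeros up to the first \<open>Free\<close> cell; \<open>DecO\<close> appends ones and overshoots by one bit,
  which \<open>DecL\<close> removes.
\<close>

datatype mode = Sim | SimR | IncW | IncR | Inc0 | Inc1 | IncZ tag
  | DecW tag | DecR | Dec0 | Dec1 | DecU | DecO | DecL

datatype tl_state = TStart | TAcc | TRej | TInit | TSt mode nat bool

text \<open>\<open>IncZ b\<close> carries the tag that the current address receives if its cell
  turns out \<open>Free\<close>. \<open>DecW b\<close> remembers the tag of the old head cell,
  because the register already shows \<open>Free\<close>. In \<open>DecU\<close> the deleted one
  comes back as a zero, except at the root, where it would be a leading zero and the run of ones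
  starts at once.\<close>

fun addr_delta :: "mode \<Rightarrow> tag \<Rightarrow> mode \<times> tag \<times> nat \<times> dir" where
  "addr_delta IncW t = (if t = Root then (IncZ Bit1, t, 2, R) else if t = Bit0 then (Inc0, t, 0, L) else (Inc1, t, 0, L))"
| "addr_delta IncR t = (if t = Root then (IncZ Bit1, t, 2, R) else if t = Bit0 then (Inc0, t, 0, L) else (Inc1, t, 0, L))"
| "addr_delta Inc0 t = (IncZ Bit1, t, 2, R)"
| "addr_delta Inc1 t = (IncR, t, 0, S)"
| "addr_delta (IncZ b) t = (if t = Free then (Sim, b, 0, S) else (IncZ Bit0, t, 1, R))"
| "addr_delta (DecW b) t = (if b = Bit0 then (Dec0, t, 0, L) else (Dec1, t, 0, L))"
| "addr_delta DecR t = (if t = Bit0 then (Dec0, t, 0, L) else (Dec1, t, 0, L))"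
| "addr_delta Dec0 t = (DecR, t, 0, S)"
| "addr_delta Dec1 t = (DecU, t, 0, S)"
| "addr_delta DecU t = (DecO, t, if t = Root then 2 else 1, R)"
| "addr_delta DecO t = (if t = Free then (DecL, t, 0, L) else (DecO, t, 2, R))"
| "addr_delta DecL t = (SimR, t, 0, S)"
| "addr_delta SimR t = (Sim, t, 0, S)"
| "addr_delta Sim t = (Sim, t, 0, S)"

text \<open>A move away from the fold goes right on the nonnegative half or left on the negative
  half, which is \<open>(d = R) \<noteq> s\<close>; it first saves the head cell with its tag. An
  inward move saves the cell as \<open>Free\<close>, since it will lie beyond the head. At the root
  an inward move only switches halves, as cell 0 holds the tape positions 0 and -1.\<close>

fun sim_delta :: "tm \<Rightarrow> tl_state \<Rightarrow> tag \<times> nat \<times> nat \<Rightarrow> tl_state \<times> (tag \<times> nat \<times> nat) \<times> nat \<times> dir" where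
  "sim_delta M TStart y = (TInit, y, 0, S)"
| "sim_delta M TAcc y = (TAcc, y, 0, S)"
| "sim_delta M TRej y = (TRej, y, 0, S)"
| "sim_delta M TInit (t, d) = (TSt Sim 0 False, (Root, d), 0, S)"
| "sim_delta M (TSt m q s) (t, a, b) =
    (if m = Sim then
       (case tm_delta M q (if s then b else a) of (q', x, d) \<Rightarrow>
          let ab = (if s then (a, x) else (x, b)) in
          if q' = 1 then (TAcc, (t, ab), 0, S)
          else if q' = 2 then (TRej, (t, ab), 0, S)
          else if d = S then (TSt Sim q' s, (t, ab), 0, S)
          else if (d = R) \<noteq> s then (TSt IncW q' s, (t, ab), 0, S)
          else if t = Root then (TSt Sim q' (\<not> s), (t, ab), 0, S)
          else (TSt (DecW t) q' s, (Free, ab), 0, S))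
     else (case addr_delta m t of (m', t', c, d) \<Rightarrow> (TSt m' q s, (t', a, b), c, d)))"

fun sim_rd :: "tl_state \<Rightarrow> bool" where
  "sim_rd TInit = True"
| "sim_rd (TSt IncR q s) = True"
| "sim_rd (TSt (IncZ t) q s) = True"
| "sim_rd (TSt DecR q s) = True"
| "sim_rd (TSt DecU q s) = True"
| "sim_rd (TSt DecO q s) = True"
| "sim_rd (TSt SimR q s) = True"
| "sim_rd _ = False"

fun sim_wr :: "tl_state \<Rightarrow> bool" where
  "sim_wr (TSt IncW q s) = True"
| "sim_wr (TSt (DecW t) q s) = True"
| "sim_wr _ = False"

type_synonym sim_conf = "tl_state \<times> (tag \<times> nat \<times> nat) \<times> (nat \<Rightarrow> tag \<times> nat \<times> nat) \<times> (nat \<Rightarrow> nat) \<times> nat"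

abbreviation sim_step :: "tm \<Rightarrow> sim_conf \<Rightarrow> sim_conf" where
  "sim_step M \<equiv> atlm_step (sim_delta M) sim_rd sim_wr (\<lambda>s. s = TAcc \<or> s = TRej)"

section \<open>Reachability within a bounded number of steps\<close>

definition reaches :: "tm \<Rightarrow> nat \<Rightarrow> sim_conf \<Rightarrow> sim_conf \<Rightarrow> bool" where
  "reaches M n c c' \<longleftrightarrow> (\<exists>m\<le>n. (sim_step M ^^ m) c = c')"

lemma reaches_refl [simp]: "reaches M n c c"
  unfolding reaches_def by (intro exI[of _ 0]) simp

lemma reaches_trans:
  assumes "reaches M n a b" "reaches M n' b c"
  shows "reaches M (n + n') a c"
proof -
  obtain m m' where "m \<le> n" "(sim_step M ^^ m) a = b" "m' \<le> n'" "(sim_step M ^^ m') b = c"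
    using assms by (auto simp: reaches_def)
  then show ?thesis
    unfolding reaches_def by (intro exI[of _ "m' + m"]) (simp add: funpow_add)
qed

lemma reaches_mono: "reaches M n a b \<Longrightarrow> n \<le> n' \<Longrightarrow> reaches M n' a b"
  unfolding reaches_def using le_trans by blast

lemma reaches_step:
  assumes "reaches M n (sim_step M a) b"
  shows "reaches M (Suc n) a b"
proof -
  have "reaches M 1 a (sim_step M a)"
    unfolding reaches_def by (intro exI[of _ 1]) simp
  from reaches_trans[OF this assms] show ?thesis by simp
qed

lemma reaches_after1:
  assumes "sim_step M a = b" "reaches M n b c" "Suc n \<le> k"
  shows "reaches M k a c"
  using reaches_mono[OF reaches_step[OF assms(2)[folded assms(1)]] assms(3)] .

lemma reaches_after2:
  assumes "sim_step M (sim_step M a) = b" "reaches M n b c" "Suc (Suc n) \<le> k"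
  shows "reaches M k a c"
  using reaches_mono[OF reaches_step[OF reaches_step[OF assms(2)[folded assms(1)]]] assms(3)] .

lemma reaches_after3:
  assumes "sim_step M (sim_step M (sim_step M a)) = b" "reaches M n b c" "Suc (Suc (Suc n)) \<le> k"
  shows "reaches M k a c"
  using reaches_mono[OF reaches_step[OF reaches_step[OF reaches_step[OF assms(2)[folded assms(1)]]]] assms(3)] .

section \<open>Tagged memory and the cost of changing an address by one\<close>

definition tag_of :: "nat \<Rightarrow> tag" where
  "tag_of i = (if i = 0 then Root else if odd i then Bit1 else Bit0)"

lemma tag_of_simps [simp]:
  "tag_of i \<noteq> Free" "tag_of i = Root \<longleftrightarrow> i = 0" "tag_of i = Bit0 \<longleftrightarrow> 0 < i \<and> even i"
  "tag_of (Suc (2 * i)) = Bit1" "0 < i \<Longrightarrow> tag_of (2 * i) = Bit0"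
  by (auto simp: tag_of_def)

text \<open>The bound \<open>n\<close> is exclusive: it is \<open>p + 1\<close> while
  \<open>p\<close> is incremented, when the old head cell keeps its tag, and \<open>p\<close> while
  \<open>p\<close> is decremented, when that cell has just been freed.\<close>

definition tagged :: "nat \<Rightarrow> (nat \<Rightarrow> nat \<times> nat) \<Rightarrow> nat \<Rightarrow> tag \<times> nat \<times> nat" where
  "tagged n D i = (if i < n then tag_of i else Free, D i)"

lemma sim_step_addr:
  assumes "m \<noteq> Sim"
  shows "sim_step M (TSt m q s, (t, D), E, A, h) = (case addr_delta m t of (m', t', b, d) \<Rightarrow>
     (TSt m' q s, if sim_rd (TSt m' q s) then E (addr_val (A(h := b))) else (t', D),
      if sim_wr (TSt m' q s) then E(addr_val (A(h := b)) := (t', D)) else E, A(h := b), move_nat d h))"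
  using assms by (cases D) (auto simp: atlm_step_def split: prod.splits)

text \<open>
  Deleting a trailing one from \<open>v\<close> halves \<open>v + 1\<close>, and appending a zero doubles the address, so
  the two phases keep \<open>(v + 1) * 2^r = p + 1\<close> and \<open>y * 2^r = p + 1\<close> respectively.
\<close>

lemma increment_ascend:
  assumes "p + 1 = (v + 1) * 2 ^ r" "m \<in> {IncW, IncR}"
  shows "\<exists>y r'. y * 2 ^ r' = p + 1 \<and> 0 < y \<and>
    reaches M (2 * v + 2) (TSt m q s, (tag_of v, D v), tagged (p + 1) D, atape v, alen v)
       (TSt (IncZ (tag_of y)) q s, tagged (p + 1) D y, tagged (p + 1) D, atape y, alen y)"
  using assms
proof (induction v arbitrary: r m rule: less_induct)
  case (less v)
  let ?c = "(TSt m q s, (tag_of v, D v), tagged (p + 1) D, atape v, alen v)"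
  let ?d = "\<lambda>y. (TSt (IncZ (tag_of y)) q s, tagged (p + 1) D y, tagged (p + 1) D, atape y, alen y)"
  have m: "m = IncW \<or> m = IncR" "m \<noteq> Sim" using less.prems by auto
  consider "v = 0" | u where "v = 2 * u" "0 < u" | u where "v = Suc (2 * u)"
    by (metis bot_nat_0.not_eq_extremum evenE mult_0_right oddE Suc_eq_plus1)
  then show ?case
  proof cases
    \<comment> \<open>All bits of \<open>p\<close> were ones and have been deleted; a new leading
      one goes onto the empty word.\<close>
    case 1
    have "sim_step M ?c = ?d 1"
      using m 1 tag_of_simps(4)[of 0] by (auto simp: sim_step_addr move_nat_def)
    then have "reaches M (2 * v + 2) ?c (?d 1)" by (rule reaches_after1[where n = 0]) auto
    moreover have "1 * 2 ^ r = p + 1" using less.prems 1 by simp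
    ultimately show ?thesis using zero_less_one by blast
  next
    case 2
    have "sim_step M (sim_step M ?c) = ?d (v + 1)"
      using m 2 by (auto simp: sim_step_addr move_nat_def)
    then have "reaches M (2 * v + 2) ?c (?d (v + 1))" by (rule reaches_after2[where n = 0]) auto
    moreover have "(v + 1) * 2 ^ r = p + 1" using less.prems by simp
    ultimately show ?thesis by (intro exI[of _ "v + 1"] exI[of _ r] conjI) simp_all
  next
    case 3
    \<comment> \<open>The invariant forces \<open>v \<le> p\<close>, so the halved address
      \<open>u\<close> lies in the tagged zone and reading its cell reveals its last bit.\<close>
    have "(v + 1) * 1 \<le> (v + 1) * 2 ^ r" by (intro mult_le_mono2) simp
    then have "v + 1 \<le> p + 1" unfolding less.prems(1) by (simp only: mult_1_right)
    then have "u < p + 1" using 3 by simp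
    then have step: "sim_step M (sim_step M ?c) = (TSt IncR q s, (tag_of u, D u), tagged (p + 1) D, atape u, alen u)"
      using m 3 by (auto simp: sim_step_addr move_nat_def tagged_def)
    have "p + 1 = (u + 1) * 2 ^ Suc r" "u < v" using less.prems(1) 3 by simp_all
    then obtain y r' where y: "y * 2 ^ r' = p + 1" "0 < y"
      "reaches M (2 * u + 2) (TSt IncR q s, (tag_of u, D u), tagged (p + 1) D, atape u, alen u) (?d y)"
      using less.IH[of u "Suc r" IncR] by blast
    have "reaches M (2 * v + 2) ?c (?d y)" using step y(3) by (rule reaches_after2) (use 3 in simp)
    with y(1,2) show ?thesis by blast
  qed
qed

text \<open>The exponent \<open>r\<close> counts the zeros still missing. At \<open>p + 1\<close>
  the tag carried by the mode goes into the register only; the external copy stays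
  \<open>Free\<close>, which \<open>sim_rel\<close> tolerates at the head.\<close>

lemma increment_descend:
  assumes "y * 2 ^ r = p + 1" "0 < y"
  shows "reaches M (r + 1) (TSt (IncZ (tag_of y)) q s, tagged (p + 1) D y, tagged (p + 1) D, atape y, alen y)
     (TSt Sim q s, (tag_of (p + 1), D (p + 1)), tagged (p + 1) D, atape (p + 1), alen (p + 1))"
  using assms
proof (induction r arbitrary: y)
  case 0
  then have "y = p + 1" by simp
  then have "sim_step M (TSt (IncZ (tag_of y)) q s, tagged (p + 1) D y, tagged (p + 1) D, atape y, alen y) =
     (TSt Sim q s, (tag_of (p + 1), D (p + 1)), tagged (p + 1) D, atape (p + 1), alen (p + 1))"
    by (simp add: tagged_def sim_step_addr move_nat_def)
  then show ?case by (rule reaches_after1[where n = 0]) auto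
next
  case (Suc r)
  have "2 * y * 2 ^ r = p + 1" using Suc.prems by simp
  moreover have "1 \<le> (2::nat) ^ r" by simp
  ultimately have "2 * y \<le> p + 1" by (metis mult.right_neutral mult_le_mono2)
  then have "y < p + 1" using Suc.prems(2) by linarith
  then have "sim_step M (TSt (IncZ (tag_of y)) q s, tagged (p + 1) D y, tagged (p + 1) D, atape y, alen y) =
      (TSt (IncZ (tag_of (2 * y))) q s, tagged (p + 1) D (2 * y), tagged (p + 1) D, atape (2 * y), alen (2 * y))"
    using Suc.prems(2) by (simp add: tagged_def[of _ _ y] sim_step_addr move_nat_def)
  then show ?case by (rule reaches_after1[OF _ Suc.IH]) (use Suc.prems in auto)
qed

lemma increment_address:
  "reaches M (10 * p + 9) (TSt IncW q s, (tag_of p, D p), tagged (p + 1) D, atape p, alen p)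
     (TSt Sim q s, (tag_of (p + 1), D (p + 1)), tagged (p + 1) D, atape (p + 1), alen (p + 1))"
proof -
  have "\<exists>y r. y * 2 ^ r = p + 1 \<and> 0 < y \<and>
    reaches M (2 * p + 2) (TSt IncW q s, (tag_of p, D p), tagged (p + 1) D, atape p, alen p)
       (TSt (IncZ (tag_of y)) q s, tagged (p + 1) D y, tagged (p + 1) D, atape y, alen y)"
    by (rule increment_ascend[of p p 0 IncW]) auto
  then obtain y r where y: "y * 2 ^ r = p + 1" "0 < y"
    "reaches M (2 * p + 2) (TSt IncW q s, (tag_of p, D p), tagged (p + 1) D, atape p, alen p)
       (TSt (IncZ (tag_of y)) q s, tagged (p + 1) D y, tagged (p + 1) D, atape y, alen y)"
    by blast
  have "r < 2 ^ r" "2 ^ r \<le> y * 2 ^ r" using y(2) by auto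
  then have "2 * p + 2 + (r + 1) \<le> 10 * p + 9" using y(1) by linarith
  with reaches_trans[OF y(3) increment_descend[OF y(1,2)]] show ?thesis
    by (rule reaches_mono)
qed

text \<open>Stripping zeros keeps \<open>v * 2 ^ r = p\<close>. Turning the last one of
  \<open>v = 2 * u + 1\<close> into a zero gives \<open>y = 2 * u\<close> with
  \<open>(y + 1) * 2 ^ Suc r = 2 * p\<close>; for \<open>v = 1\<close> the machine passes to
  \<open>y = 1\<close> with exponent \<open>r\<close>. The target is \<open>2 * p\<close> and not
  \<open>p\<close> because of the bit of overshoot.\<close>

lemma decrement_ascend:
  assumes "v * 2 ^ r = p" "0 < p" "m = DecW (tag_of v) \<or> m = DecR \<and> t = tag_of v"
  shows "\<exists>y r'. (y + 1) * 2 ^ r' = 2 * p \<and> 0 < y \<and>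
    reaches M (2 * v + 1) (TSt m q s, (t, d), tagged p D, atape v, alen v)
       (TSt DecO q s, tagged p D y, tagged p D, atape y, alen y)"
  using assms
proof (induction v arbitrary: r m t d rule: less_induct)
  case (less v)
  let ?c = "(TSt m q s, (t, d), tagged p D, atape v, alen v)"
  let ?d = "\<lambda>y. (TSt DecO q s, tagged p D y, tagged p D, atape y, alen y)"
  have v: "0 < v" "v \<le> p" using less.prems by auto
  have m: "m \<noteq> Sim" using less.prems by auto
  consider u where "v = 2 * u" "0 < u" | "v = 1" | u where "v = Suc (2 * u)" "0 < u"
    using v(1) by (metis bot_nat_0.not_eq_extremum evenE mult_0_right oddE Suc_eq_plus1 One_nat_def)
  then show ?case
  proof cases
    case 1
    have "u < p" using v 1 by auto
    then have step: "sim_step M (sim_step M ?c) = (TSt DecR q s, (tag_of u, D u), tagged p D, atape u, alen u)"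
      using m 1 less.prems(3) by (auto simp: sim_step_addr move_nat_def tagged_def)
    obtain y r' where y: "(y + 1) * 2 ^ r' = 2 * p" "0 < y"
      "reaches M (2 * u + 1) (TSt DecR q s, (tag_of u, D u), tagged p D, atape u, alen u) (?d y)"
      using less.IH[of u "Suc r" DecR "tag_of u" "D u"] less.prems 1 by auto
    have "reaches M (2 * v + 1) ?c (?d y)" using step y(3) by (rule reaches_after2) (use 1 in simp)
    with y(1,2) show ?thesis by blast
  next
    case 2
    have "sim_step M (sim_step M (sim_step M ?c)) = ?d 1"
      using m 2 less.prems(2,3)
      by (auto simp: sim_step_addr move_nat_def tagged_def tag_of_def)
    then have "reaches M (2 * v + 1) ?c (?d 1)" by (rule reaches_after3[where n = 0]) (use 2 in auto)
    moreover have "(1 + 1) * 2 ^ r = 2 * p" using less.prems 2 by simp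
    ultimately show ?thesis using zero_less_one by blast
  next
    case 3
    have "u < p" using v 3 by auto
    then have "sim_step M (sim_step M (sim_step M ?c)) = ?d (2 * u)"
      using m 3 less.prems(3)
      by (auto simp: sim_step_addr move_nat_def tagged_def)
    then have "reaches M (2 * v + 1) ?c (?d (2 * u))" by (rule reaches_after3[where n = 0]) (use 3 in auto)
    moreover have "(2 * u + 1) * 2 ^ Suc r = 2 * p" "0 < 2 * u" using less.prems 3 by simp_all
    ultimately show ?thesis by (intro exI[of _ "2 * u"] exI[of _ "Suc r"] conjI)
  qed
qed

text \<open>The wanted address \<open>p - 1\<close> is tagged, so nothing distinguishes it from the
  shorter addresses before it. One more one leads to \<open>2 * p - 1\<close>, the first free cell
  met, and dropping that bit gives \<open>p - 1\<close>. Every earlier \<open>y\<close> satisfies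
  \<open>y + 1 \<le> p\<close>.\<close>

lemma decrement_descend:
  assumes "(y + 1) * 2 ^ r = 2 * p" "0 < y"
  shows "reaches M (r + 3) (TSt DecO q s, tagged p D y, tagged p D, atape y, alen y)
     (TSt Sim q s, (tag_of (p - 1), D (p - 1)), tagged p D, atape (p - 1), alen (p - 1))"
  using assms
proof (induction r arbitrary: y)
  case 0
  let ?c = "(TSt DecO q s, tagged p D y, tagged p D, atape y, alen y)"
  obtain n where n: "p = Suc n" using 0 by (cases p) auto
  then have "y = Suc (2 * n)" using 0 by auto
  then have "sim_step M (sim_step M (sim_step M ?c)) =
      (TSt Sim q s, (tag_of (p - 1), D (p - 1)), tagged p D, atape (p - 1), alen (p - 1))"
    by (auto simp: n sim_step_addr move_nat_def tagged_def)
  then show ?case by (rule reaches_after3[where n = 0]) auto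
next
  case (Suc r)
  have "(y + 1) * 2 ^ r = p" using Suc.prems by simp
  moreover have "1 \<le> (2::nat) ^ r" by simp
  ultimately have "y < p" by (metis Suc_eq_plus1 Suc_le_eq mult.right_neutral mult_le_mono2)
  then have "sim_step M (TSt DecO q s, tagged p D y, tagged p D, atape y, alen y) =
      (TSt DecO q s, tagged p D (Suc (2 * y)), tagged p D, atape (Suc (2 * y)), alen (Suc (2 * y)))"
    by (simp add: tagged_def[of _ _ y] sim_step_addr move_nat_def)
  then show ?case by (rule reaches_after1[OF _ Suc.IH]) (use Suc.prems in auto)
qed

lemma decrement_address:
  assumes "0 < p"
  shows "reaches M (10 * p + 9) (TSt (DecW (tag_of p)) q s, (t, d), tagged p D, atape p, alen p)
     (TSt Sim q s, (tag_of (p - 1), D (p - 1)), tagged p D, atape (p - 1), alen (p - 1))"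
proof -
  have "\<exists>y r. (y + 1) * 2 ^ r = 2 * p \<and> 0 < y \<and>
    reaches M (2 * p + 1) (TSt (DecW (tag_of p)) q s, (t, d), tagged p D, atape p, alen p)
       (TSt DecO q s, tagged p D y, tagged p D, atape y, alen y)"
    by (rule decrement_ascend[of p 0 p "DecW (tag_of p)"]) (use assms in auto)
  then obtain y r where y: "(y + 1) * 2 ^ r = 2 * p" "0 < y"
    "reaches M (2 * p + 1) (TSt (DecW (tag_of p)) q s, (t, d), tagged p D, atape p, alen p)
       (TSt DecO q s, tagged p D y, tagged p D, atape y, alen y)"
    by blast
  have "r < 2 ^ r" "2 ^ r \<le> (y + 1) * 2 ^ r" using y(2) by auto
  then have "2 * p + 1 + (r + 3) \<le> 10 * p + 9" using y(1) by linarith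
  with reaches_trans[OF y(3) decrement_descend[OF y(1,2)]] show ?thesis
    by (rule reaches_mono)
qed

section \<open>Simulation of a Turing machine\<close>

text \<open>
  External cell \<open>i\<close> carries the tape cells \<open>i\<close> and \<open>- 1 - i\<close>.  In \<open>sim_rel\<close> the current
  content of the head cell is the main memory register; its external copy may be stale.
\<close>

definition fold_tape :: "(int \<Rightarrow> nat) \<Rightarrow> nat \<Rightarrow> nat \<times> nat" where
  "fold_tape tp i = (tp (int i), tp (- 1 - int i))"

definition fold_pos :: "int \<Rightarrow> nat" where
  "fold_pos h = (if h < 0 then nat (- 1 - h) else nat h)"

definition sim_rel :: "tm_conf \<Rightarrow> sim_conf \<Rightarrow> bool" where
  "sim_rel = (\<lambda>(q, tp, h) c. \<exists>E.
     c = (TSt Sim q (h < 0), (tag_of (fold_pos h), fold_tape tp (fold_pos h)), E, atape (fold_pos h), alen (fold_pos h)) \<and>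
     (\<forall>i. i \<noteq> fold_pos h \<longrightarrow> E i = tagged (fold_pos h) (fold_tape tp) i))"

lemma fold_tape_upd:
  "fold_tape (tp(h := x)) = (fold_tape tp)(fold_pos h :=
     if h < 0 then (tp (int (fold_pos h)), x) else (x, tp (- 1 - int (fold_pos h))))"
  by (auto simp: fold_tape_def fold_pos_def fun_eq_iff)

lemma sim_rel_step:
  assumes rel: "sim_rel (q, tp, h) c" and q: "\<not> tm_halted q"
    and step: "tm_step M (q, tp, h) = (q', tp', h')"
  shows "\<exists>c'. reaches M (10 * fold_pos h + 10) c c' \<and>
    (if tm_halted q' then fst c' = (if q' = 1 then TAcc else TRej) else sim_rel (q', tp', h') c')"
proof -
  let ?p = "fold_pos h"
  obtain E where c: "c = (TSt Sim q (h < 0), (tag_of ?p, fold_tape tp ?p), E, atape ?p, alen ?p)"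
    and E: "\<And>i. i \<noteq> ?p \<Longrightarrow> E i = tagged ?p (fold_tape tp) i"
    using rel by (auto simp: sim_rel_def)
  obtain x d where \<delta>: "tm_delta M q (tp h) = (q', x, d)"
    and tp': "tp' = tp(h := x)" and h': "h' = move_int d h"
    using step q by (auto simp: tm_step_def split: prod.splits)
  have sym: "(if h < 0 then tp (- 1 - int ?p) else tp (int ?p)) = tp h"
    by (auto simp: fold_pos_def)
  have ab: "(if h < 0 then (tp (int ?p), x) else (x, tp (- 1 - int ?p))) = fold_tape tp' ?p"
    unfolding tp' fold_tape_upd by simp
  have other: "fold_tape tp' i = fold_tape tp i" if "i \<noteq> ?p" for i
    unfolding tp' fold_tape_upd using that by simp
  \<comment> \<open>The tape changes only at the head, where the external copy may be stale anyway,
    so all other cells are correct for the new tape.\<close>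
  have E': "E i = tagged ?p (fold_tape tp') i" if "i \<noteq> ?p" for i
    using E other that by (simp add: tagged_def)
  have \<delta>': "sim_delta M (TSt Sim q (h < 0)) (tag_of ?p, fold_tape tp ?p) =
     (if q' = 1 then (TAcc, (tag_of ?p, fold_tape tp' ?p), 0, S)
      else if q' = 2 then (TRej, (tag_of ?p, fold_tape tp' ?p), 0, S)
      else if d = S then (TSt Sim q' (h < 0), (tag_of ?p, fold_tape tp' ?p), 0, S)
      else if (d = R) \<noteq> (h < 0) then (TSt IncW q' (h < 0), (tag_of ?p, fold_tape tp' ?p), 0, S)
      else if ?p = 0 then (TSt Sim q' (\<not> h < 0), (tag_of ?p, fold_tape tp' ?p), 0, S)
      else (TSt (DecW (tag_of ?p)) q' (h < 0), (Free, fold_tape tp' ?p), 0, S))"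
    using sym ab by (simp add: fold_tape_def[of tp] \<delta> Let_def)
  note st = c atlm_step_def \<delta>' move_nat_def
  consider "tm_halted q'" | "\<not> tm_halted q'" "d = S" | "\<not> tm_halted q'" "d \<noteq> S" "(d = R) \<noteq> (h < 0)"
    | "\<not> tm_halted q'" "d \<noteq> S" "(d = R) = (h < 0)" "?p = 0"
    | "\<not> tm_halted q'" "d \<noteq> S" "(d = R) = (h < 0)" "0 < ?p" by blast
  then show ?thesis
  proof cases
    case 1
    then have "fst (sim_step M c) = (if q' = 1 then TAcc else TRej)"
      by (auto simp: st tm_halted_def)
    moreover have "reaches M (10 * ?p + 10) c (sim_step M c)"
      by (rule reaches_after1[OF refl reaches_refl[of _ 0]]) simp
    ultimately show ?thesis using 1 by (intro exI[of _ "sim_step M c"]) simp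
  next
    case 2
    then have "sim_step M c = (TSt Sim q' (h < 0), (tag_of ?p, fold_tape tp' ?p), E, atape ?p, alen ?p)"
      by (auto simp: st tm_halted_def)
    moreover have "h' = h" using 2 by (simp add: h' move_int_def)
    ultimately have "sim_rel (q', tp', h') (sim_step M c)" using E' by (auto simp: sim_rel_def)
    moreover have "reaches M (10 * ?p + 10) c (sim_step M c)"
      by (rule reaches_after1[OF refl reaches_refl[of _ 0]]) simp
    ultimately show ?thesis using 2 by (intro exI[of _ "sim_step M c"]) simp
  next
    case 3
    have "E(?p := (tag_of ?p, fold_tape tp' ?p)) = tagged (?p + 1) (fold_tape tp')"
      using E' by (auto simp: tagged_def fun_eq_iff)
    with 3 have 1: "sim_step M c =
        (TSt IncW q' (h < 0), (tag_of ?p, fold_tape tp' ?p), tagged (?p + 1) (fold_tape tp'), atape ?p, alen ?p)"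
      by (auto simp: st tm_halted_def)
    let ?c' = "(TSt Sim q' (h < 0), (tag_of (?p + 1), fold_tape tp' (?p + 1)), tagged (?p + 1) (fold_tape tp'),
      atape (?p + 1), alen (?p + 1))"
    have "(h' < 0) = (h < 0)" "fold_pos h' = ?p + 1"
      using 3 by (cases d; auto simp: h' move_int_def fold_pos_def)+
    then have "sim_rel (q', tp', h') ?c'" by (auto simp: sim_rel_def)
    moreover have "reaches M (10 * ?p + 10) c ?c'"
      by (rule reaches_after1[OF 1 increment_address]) simp
    ultimately show ?thesis using 3 by (intro exI[of _ ?c']) simp
  next
    case 4
    then have "sim_delta M (TSt Sim q (h < 0)) (tag_of ?p, fold_tape tp ?p) =
        (TSt Sim q' (\<not> h < 0), (tag_of ?p, fold_tape tp' ?p), 0, S)"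
      unfolding \<delta>' by (auto simp: tm_halted_def)
    then have "sim_step M c = (TSt Sim q' (\<not> h < 0), (tag_of ?p, fold_tape tp' ?p), E, atape ?p, alen ?p)"
      by (simp add: c atlm_step_def move_nat_def)
    moreover have "(h' < 0) = (\<not> h < 0)" "fold_pos h' = ?p"
      using 4 by (cases d; auto simp: h' move_int_def fold_pos_def split: if_splits)+
    ultimately have "sim_rel (q', tp', h') (sim_step M c)" using E' by (auto simp: sim_rel_def)
    moreover have "reaches M (10 * ?p + 10) c (sim_step M c)"
      by (rule reaches_after1[OF refl reaches_refl[of _ 0]]) simp
    ultimately show ?thesis using 4 by (intro exI[of _ "sim_step M c"]) simp
  next
    case 5
    have "E(?p := (Free, fold_tape tp' ?p)) = tagged ?p (fold_tape tp')"
      using E' by (auto simp: tagged_def fun_eq_iff)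
    with 5 have 1: "sim_step M c =
        (TSt (DecW (tag_of ?p)) q' (h < 0), (Free, fold_tape tp' ?p), tagged ?p (fold_tape tp'), atape ?p, alen ?p)"
      by (auto simp: st tm_halted_def)
    let ?c' = "(TSt Sim q' (h < 0), (tag_of (?p - 1), fold_tape tp' (?p - 1)), tagged ?p (fold_tape tp'),
      atape (?p - 1), alen (?p - 1))"
    have "(h' < 0) = (h < 0)" "fold_pos h' = ?p - 1"
      using 5 by (cases d; auto simp: h' move_int_def fold_pos_def split: if_splits)+
    \<comment> \<open>Cell \<open>?p - 1\<close> becomes the head cell and is exempt; no other cell
      changes its tag when the bound drops by one.\<close>
    moreover have "tagged ?p (fold_tape tp') i = tagged (?p - 1) (fold_tape tp') i" if "i \<noteq> ?p - 1" for i
      using that 5(4) by (auto simp: tagged_def)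
    ultimately have "sim_rel (q', tp', h') ?c'" by (auto simp: sim_rel_def)
    moreover have "reaches M (10 * ?p + 10) c ?c'"
      by (rule reaches_after1[OF 1 decrement_address[OF 5(4)]]) simp
    ultimately show ?thesis using 5 by (intro exI[of _ ?c']) simp
  qed
qed

abbreviation sim_input :: "nat list \<Rightarrow> sim_conf" where
  "sim_input w \<equiv> (TStart, (Free, 0, 0), (\<lambda>i. (Free, if i < length w then w ! i else 0, 0)), (\<lambda>_. 0), 0)"

text \<open>The folded position grows by at most one per step, so step \<open>t + 1\<close> of
  \<open>M\<close> costs at most \<open>10 * t + 10\<close> steps, which the difference of
  \<open>10 * (t + 2)^2\<close> and \<open>10 * (t + 1)^2\<close> covers.\<close>

lemma sim_run:
  assumes "tm_run M w t = (q, tp, h)"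
  shows "fold_pos h \<le> t \<and> (\<exists>c. reaches M (10 * (t + 1)^2) (sim_input w) c \<and>
    (if tm_halted q then fst c = (if q = 1 then TAcc else TRej) else sim_rel (q, tp, h) c))"
  using assms
proof (induction t arbitrary: q tp h)
  case 0
  then have init: "q = 0" "h = 0" "tp = (\<lambda>i. if 0 \<le> i \<and> i < int (length w) then w ! nat i else 0)"
    by (auto simp: tm_run_def tm_init_def)
  \<comment> \<open>Two setup steps: entering \<open>TInit\<close> reads cell 0, the address of the
    blank tape, and the next transition tags it as the root.\<close>
  let ?c = "sim_step M (sim_step M (sim_input w))"
  have "sim_rel (q, tp, h) ?c"
    by (auto simp: init sim_rel_def atlm_step_def move_nat_def tagged_def fold_tape_def fold_pos_def tag_of_def)
  moreover have "reaches M (10 * (0 + 1)^2) (sim_input w) ?c"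
    by (rule reaches_after2[OF refl reaches_refl[of _ 0]]) simp
  ultimately have "\<exists>c. reaches M (10 * (0 + 1)^2) (sim_input w) c \<and> sim_rel (q, tp, h) c" by blast
  then show ?case by (simp add: init fold_pos_def tm_halted_def)
next
  case (Suc t)
  obtain q0 tp0 h0 where r: "tm_run M w t = (q0, tp0, h0)" using prod_cases3 by blast
  then have st: "tm_step M (q0, tp0, h0) = (q, tp, h)" using Suc.prems by (simp add: tm_run_def)
  obtain c where c: "fold_pos h0 \<le> t" "reaches M (10 * (t + 1)^2) (sim_input w) c"
    "if tm_halted q0 then fst c = (if q0 = 1 then TAcc else TRej) else sim_rel (q0, tp0, h0) c"
    using Suc.IH[OF r] by blast
  show ?case
  proof (cases "tm_halted q0")
    case True
    then have eq: "q = q0" "tp = tp0" "h = h0" using st by (auto simp: tm_step_def)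
    have "reaches M (10 * (Suc t + 1)^2) (sim_input w) c"
      using c(2) by (rule reaches_mono) (simp add: power_mono)
    then show ?thesis using c True eq by (intro conjI exI[of _ c]) auto
  next
    case False
    have "fold_pos h \<le> fold_pos h0 + 1"
      using st False by (auto simp: tm_step_def move_int_def fold_pos_def split: prod.splits dir.splits)
    then have pos: "fold_pos h \<le> Suc t" using c(1) by simp
    have "sim_rel (q0, tp0, h0) c" using c(3) False by simp
    from sim_rel_step[OF this False st]
    obtain c' where c': "reaches M (10 * fold_pos h0 + 10) c c'"
      "if tm_halted q then fst c' = (if q = 1 then TAcc else TRej) else sim_rel (q, tp, h) c'"
      by blast
    have "10 * (t + 1)^2 + (10 * fold_pos h0 + 10) \<le> 10 * (Suc t + 1)^2"
      using c(1) by (simp add: power2_eq_square)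
    with reaches_trans[OF c(2) c'(1)] have "reaches M (10 * (Suc t + 1)^2) (sim_input w) c'"
      by (rule reaches_mono)
    with pos c'(2) show ?thesis by blast
  qed
qed

section \<open>Finiteness of the simulator and its realization as a TM-TLM\<close>

lemma UNIV_tag: "(UNIV :: tag set) = {Free, Bit0, Bit1, Root}"
  using tag.exhaust by blast

lemma finite_mode: "finite (UNIV :: mode set)"
proof -
  have "m \<in> {Sim, SimR, IncW, IncR, Inc0, Inc1, DecR, Dec0, Dec1, DecU, DecO, DecL}
      \<union> IncZ ` UNIV \<union> DecW ` UNIV" for m
    by (cases m) auto
  then have "(UNIV :: mode set) \<subseteq> {Sim, SimR, IncW, IncR, Inc0, Inc1, DecR, Dec0, Dec1, DecU, DecO, DecL}
      \<union> IncZ ` UNIV \<union> DecW ` UNIV" by blast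
  then show ?thesis by (rule finite_subset) (simp add: UNIV_tag)
qed

lemma tlm_simulates_tm:
  assumes wf: "tm_wf M"
  obtains T where "tlm_wf T"
    "\<And>w t. set w \<subseteq> {..<4} \<Longrightarrow> tm_halted (fst (tm_run M w t)) \<Longrightarrow>
      \<exists>t'\<le>10 * (t + 1)^2. tm_halted (c_state (tlm_run T 1 w t')) \<and>
        (c_state (tlm_run T 1 w t') = 1 \<longleftrightarrow> fst (tm_run M w t) = 1)"
proof -
  let ?St = "{TStart, TAcc, TRej, TInit} \<union> (\<lambda>(m, q, s). TSt m q s) ` (UNIV \<times> {..<tm_nq M} \<times> UNIV)"
  let ?Sy = "(UNIV :: tag set) \<times> {..<tm_ns M} \<times> {..<tm_ns M}"
  \<comment> \<open>An input symbol counts as an untagged cell with a blank second track, so the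
    initial external memory already is the folded input tape.\<close>
  define ys :: "(tag \<times> nat \<times> nat) list" where "ys = map (\<lambda>a. (Free, a, 0)) [0, 1, 2, 3]"
  have n: "3 \<le> tm_nq M" "4 \<le> tm_ns M" using wf by (auto simp: tm_wf_def)
  have sets: "finite ?St" "finite ?Sy" "distinct [TStart, TAcc, TRej]" "{TStart, TAcc, TRej} \<subseteq> ?St"
    "distinct ys" "length ys = 4" "set ys \<subseteq> ?Sy"
    using n finite_mode by (auto simp: UNIV_tag ys_def)
  have addr: "b \<le> 2" if "addr_delta m t = (m', t', b, d)" for m t m' t' b d
    using that by (cases m) (auto split: if_splits)
  have closed: "s' \<in> ?St \<and> y' \<in> ?Sy \<and> b \<le> 2"
    if "s \<in> ?St" "y \<in> ?Sy" "sim_delta M s y = (s', y', b, d)" for s y s' y' b d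
  proof -
    obtain t a a' where y: "y = (t, a, a')" by (cases y)
    show ?thesis
    proof (cases s)
      case (TSt m q sd)
      have q: "q < tm_nq M" "a < tm_ns M" "a' < tm_ns M" using that TSt y by auto
      show ?thesis
      proof (cases "m = Sim")
        case True
        obtain q' x dd where \<delta>: "tm_delta M q (if sd then a' else a) = (q', x, dd)"
          using prod_cases3 by blast
        have "q' < tm_nq M" "x < tm_ns M"
          using wf q \<delta> unfolding tm_wf_def by (metis fst_conv snd_conv)+
        then show ?thesis using that(3) q True TSt y \<delta>
          by (auto simp: Let_def image_iff split: if_splits)
      next
        case False
        then show ?thesis using that(3) q TSt y addr
          by (auto simp: image_iff split: prod.splits)
      qed
    qed (use that n y in \<open>auto simp: image_iff\<close>)
  qed
  have rw: "\<not> sim_wr s" if "sim_rd s" for s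
    using that by (cases s rule: sim_rd.cases) auto
  have rw': "s \<notin> {TStart, TAcc, TRej}" if "sim_rd s \<or> sim_wr s" for s
    using that by auto
  obtain T where T: "tlm_wf T"
    "\<And>w t s y E A h. set w \<subseteq> {..<4} \<Longrightarrow>
       (sim_step M ^^ t)
          (TStart, ys ! 0, (\<lambda>i. if i < length w then ys ! (w ! i) else ys ! 0), (\<lambda>_. 0), 0) = (s, y, E, A, h) \<Longrightarrow>
       (c_state (tlm_run T 1 w t) = 1 \<longleftrightarrow> s = TAcc) \<and> (c_state (tlm_run T 1 w t) = 2 \<longleftrightarrow> s = TRej)"
    by (rule tlm_realization[OF sets closed rw rw']) (assumption | rule that)+
  show ?thesis
  proof (rule that[OF T(1)])
    fix w t
    assume w: "set w \<subseteq> {..<4}" and hlt: "tm_halted (fst (tm_run M w t))"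
    obtain q tp h where r: "tm_run M w t = (q, tp, h)" using prod_cases3 by blast
    obtain c where "reaches M (10 * (t + 1)^2) (sim_input w) c" and c: "fst c = (if q = 1 then TAcc else TRej)"
      using sim_run[OF r] hlt r by auto
    then obtain t' where t': "t' \<le> 10 * (t + 1)^2" "(sim_step M ^^ t') (sim_input w) = c"
      by (auto simp: reaches_def)
    have nth: "ys ! a = (Free, a, 0)" if "a < 4" for a
      using that by (auto simp: ys_def less_Suc_eq eval_nat_numeral)
    have "w ! i < 4" if "i < length w" for i
      using w nth_mem[OF that] by blast
    then have eq: "(TStart, ys ! 0, (\<lambda>i. if i < length w then ys ! (w ! i) else ys ! 0), (\<lambda>_. 0), 0) = sim_input w"
      using nth by (auto simp: fun_eq_iff)
    obtain s y E A h where sc: "c = (s, y, E, A, h)" by (cases c)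
    have "(c_state (tlm_run T 1 w t') = 1 \<longleftrightarrow> s = TAcc) \<and> (c_state (tlm_run T 1 w t') = 2 \<longleftrightarrow> s = TRej)"
      by (rule T(2)[OF w]) (unfold eq t'(2) sc, rule refl)
    then show "\<exists>t'\<le>10 * (t + 1)^2. tm_halted (c_state (tlm_run T 1 w t')) \<and>
        (c_state (tlm_run T 1 w t') = 1 \<longleftrightarrow> fst (tm_run M w t) = 1)"
      using t'(1) c sc r by (intro exI[of _ t']) (auto simp: tm_halted_def split: if_splits)
  qed
qed

theorem theorem4:
  fixes P :: "(bool list \<times> nat) set"
  assumes "fpt P"
  shows "\<exists>g. computable g \<and>
    (\<exists>T mem c. tlm_wf T \<and>
       (\<forall>k. 0 < mem k \<and> mem k \<le> c * (g k) ^ c + c) \<and>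
       tlm_solves T mem P
         (\<lambda>x k. c * (g k)^2 * (max 1 (input_size x k)) ^ (g k))
         (\<lambda>x k. c * (g k)^2 * (max 1 (input_size x k)) ^ (g k)))"
proof -
  obtain M f c where wf: "tm_wf M" and f: "computable f"
    and dec: "tm_decides_in_time M P (\<lambda>x k. f k * (max 1 (input_size x k)) ^ c)"
    using assms unfolding fpt_def by blast
  obtain T where T: "tlm_wf T"
    "\<And>w t. set w \<subseteq> {..<4} \<Longrightarrow> tm_halted (fst (tm_run M w t)) \<Longrightarrow>
      \<exists>t'\<le>10 * (t + 1)^2. tm_halted (c_state (tlm_run T 1 w t')) \<and>
        (c_state (tlm_run T 1 w t') = 1 \<longleftrightarrow> fst (tm_run M w t) = 1)"
    using tlm_simulates_tm[OF wf] by blast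
  \<comment> \<open>\<open>f k + 1\<close> absorbs the increment in \<open>t + 1\<close>, and
    \<open>2 * c\<close> is the exponent of the input size after squaring; both are at most
    \<open>g k\<close>.\<close>
  define g where "g k = f k + (2 * c + 1)" for k
  have g: "computable g"
    unfolding g_def using f by (rule computable_add_const)
  have "\<exists>t. let cf = tlm_run T 1 (encode x k) t in tm_halted (c_state cf) \<and>
      c_time cf \<le> 10 * (g k)^2 * (max 1 (input_size x k)) ^ (g k) \<and>
      c_io cf \<le> 10 * (g k)^2 * (max 1 (input_size x k)) ^ (g k) \<and>
      (c_state cf = 1 \<longleftrightarrow> (x, k) \<in> P)" for x k
  proof -
    let ?n = "max 1 (input_size x k)"
    obtain t where t: "t \<le> f k * ?n ^ c" "tm_halted (fst (tm_run M (encode x k) t))"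
      "fst (tm_run M (encode x k) t) = 1 \<longleftrightarrow> (x, k) \<in> P"
      using dec unfolding tm_decides_in_time_def by blast
    have "set (encode x k) \<subseteq> {..<4}" by (auto simp: encode_def)
    then obtain t' where t': "t' \<le> 10 * (t + 1)^2" "tm_halted (c_state (tlm_run T 1 (encode x k) t'))"
      "c_state (tlm_run T 1 (encode x k) t') = 1 \<longleftrightarrow> (x, k) \<in> P"
      using T(2)[OF _ t(2)] t(3) by blast
    \<comment> \<open>The base is at least 1 by \<open>max\<close>, so \<open>t + 1\<close> is
      bounded by a multiple of \<open>?n ^ c\<close>, and exponents may later be raised to
      \<open>g k\<close>.\<close>
    have "1 \<le> ?n ^ c" by simp
    then have "t + 1 \<le> (f k + 1) * ?n ^ c" using t(1) unfolding add_mult_distrib by linarith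
    also have "\<dots> \<le> g k * ?n ^ c" by (intro mult_le_mono1) (simp add: g_def)
    finally have "(t + 1)^2 \<le> (g k * ?n ^ c)^2" by (rule power_mono) simp
    also have "\<dots> = (g k)^2 * ?n ^ (2 * c)"
      by (simp only: power_mult_distrib power_mult[symmetric] mult.commute[of c 2])
    also have "\<dots> \<le> (g k)^2 * ?n ^ g k"
      by (intro mult_le_mono2 power_increasing) (simp_all add: g_def)
    finally have "t' \<le> 10 * (g k)^2 * ?n ^ g k" using t'(1) by simp
    then show ?thesis
      using t'(2,3) tlm_run_cost[of T 1 "encode x k" t']
      by (intro exI[of _ t']) (auto simp: Let_def)
  qed
  then have "tlm_solves T (\<lambda>_. 1) P
         (\<lambda>x k. 10 * (g k)^2 * (max 1 (input_size x k)) ^ (g k))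
         (\<lambda>x k. 10 * (g k)^2 * (max 1 (input_size x k)) ^ (g k))"
    unfolding tlm_solves_def by blast
  with g T(1) show ?thesis
    by (intro exI[of _ g] conjI exI[of _ T] exI[of _ "\<lambda>_. 1"] exI[of _ 10]) auto
qed

end
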